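(* Let a semisimple braided tensor category (as specified in the context) be given, with simple objects indexed by the finite set $\mathcal{I}$ and matrix $S=(S_{i,j})_{i,j\in\mathcal{I}}$. The following are equivalent: 1. $1\in im(S)$, i.e. there is a vector $\hat d\in\mathbb{C}^{\mathcal{I}}$ with $\sum_{j\in\mathcal{I}}\hat d(j)\,S_{j,i}=\delta_{i,1}$ for all $i\in\mathcal{I}$. 2. $\sum_{j\in\mathcal{I}}dim(j)\,S_{j,i}=\mathcal{D}^2\,\delta_{i,1}$ for all $i\in\mathcal{I}$. 3. $S$ is invertible.
   Context: The category is an abelian, strict, semisimple, balanced, rigid braided tensor category over $\mathbb{C}$ with simple unit object $1$, and with a finite set $\mathcal{I}\ni1$ of representatives of the isomorphism classes of simple objects, $End(j)=\mathbb{C}$ for $j\in\mathcal{I}$. The braiding is $c_{i,j}:i\otimes j\to j\otimes i$ and $\theta$ is the balancing, $\theta_{i\otimes j}=c_{j,i}c_{i,j}(\theta_i\otimes\theta_j)$. Braiding, balancing and rigidity define the canonical (cyclic, $\otimes$-multiplicative) trace $tr_X:End(X)\to End(1)=\mathbb{C}$, given by an annulus with an endomorphism inserted. The $S$-matrix and dimensions are $$S_{i,j}=tr_{i\otimes j}(c_{j,i}c_{i,j}),\qquad dim(j)=S_{1,j}=tr_j(1),$$ and $dim(j)\ne0$ for all $j\in\mathcal{I}$ is part of the semisimplicity condition. The vector $1$ in $im(S)$ is the basis vector of $\mathbb{C}^{\mathcal{I}}$ corresponding to the unit object. Moreover $\mathcal{D}^2=\sum_{j\in\mathcal{I}}dim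(j)^2$.
   Formalization: The balancing is also assumed compatible with duality, θ_{X*} = (θ_X)*; without this the claim fails: for Z/3-graded vector spaces with trivial braiding and θ a nontrivial character, condition 2 holds (0 = 0) while 1 and 3 fail. *)

theory Defs
  imports "HOL-Analysis.Analysis"
begin

section \<open>Linear and abelian categories\<close>

text \<open>
  Every element of the type \<open>'o\<close> is an object.  All morphism spaces are linear subspaces of one
  ambient complex vector space \<open>'m\<close>.  This is no restriction: for a given linear category take the
  direct sum of all its morphism spaces as ambient space and extend composition and tensor product
  of morphisms bilinearly (by zero on summands that do not match).  The values of the operations
  outside the morphism spaces are never constrained.
\<close>

record ('o, 'm) linear_cat =
  hom :: "'o \<Rightarrow> 'o \<Rightarrow> 'm set"
  cmp :: "'m \<Rightarrow> 'm \<Rightarrow> 'm"  (infixr "\<cdot>\<index>" 70)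
  idm :: "'o \<Rightarrow> 'm"
  smult :: "complex \<Rightarrow> 'm \<Rightarrow> 'm"  (infixr "\<odot>\<index>" 75)

locale linear_category = vector_space "smult C"
  for C :: "('o, 'm :: ab_group_add, 'x) linear_cat_scheme" (structure) +
  assumes hom_subspace: "module.subspace (smult C) (hom C X Y)"
    and cmp_in_hom: "\<lbrakk>g \<in> hom C Y Z; f \<in> hom C X Y\<rbrakk> \<Longrightarrow> g \<cdot> f \<in> hom C X Z"
    and id_in_hom: "idm C X \<in> hom C X X"
    and cmp_assoc: "\<lbrakk>h \<in> hom C Z W; g \<in> hom C Y Z; f \<in> hom C X Y\<rbrakk> \<Longrightarrow> (h \<cdot> g) \<cdot> f = h \<cdot> (g \<cdot> f)"
    and cmp_id_left: "f \<in> hom C X Y \<Longrightarrow> idm C Y \<cdot> f = f"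
    and cmp_id_right: "f \<in> hom C X Y \<Longrightarrow> f \<cdot> idm C X = f"
    and cmp_add_left: "\<lbrakk>g \<in> hom C Y Z; g' \<in> hom C Y Z; f \<in> hom C X Y\<rbrakk>
          \<Longrightarrow> (g + g') \<cdot> f = (g \<cdot> f) + (g' \<cdot> f)"
    and cmp_add_right: "\<lbrakk>g \<in> hom C Y Z; f \<in> hom C X Y; f' \<in> hom C X Y\<rbrakk>
          \<Longrightarrow> g \<cdot> (f + f') = (g \<cdot> f) + (g \<cdot> f')"
    and cmp_smult_left: "\<lbrakk>g \<in> hom C Y Z; f \<in> hom C X Y\<rbrakk> \<Longrightarrow> (a \<odot> g) \<cdot> f = a \<odot> (g \<cdot> f)"
    and cmp_smult_right: "\<lbrakk>g \<in> hom C Y Z; f \<in> hom C X Y\<rbrakk> \<Longrightarrow> g \<cdot> (a \<odot> f) = a \<odot> (g \<cdot> f)"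

context
  fixes C :: "('o, 'm :: ab_group_add, 'x) linear_cat_scheme" (structure)
begin

definition is_iso :: "'o \<Rightarrow> 'o \<Rightarrow> 'm \<Rightarrow> bool" where
  "is_iso X Y f \<longleftrightarrow>
     f \<in> hom C X Y \<and> (\<exists>g \<in> hom C Y X. g \<cdot> f = idm C X \<and> f \<cdot> g = idm C Y)"

definition isomorphic :: "'o \<Rightarrow> 'o \<Rightarrow> bool" where
  "isomorphic X Y \<longleftrightarrow> (\<exists>f. is_iso X Y f)"

definition monic :: "'o \<Rightarrow> 'o \<Rightarrow> 'm \<Rightarrow> bool" where
  "monic X Y f \<longleftrightarrow> f \<in> hom C X Y \<and>
     (\<forall>W. \<forall>g \<in> hom C W X. \<forall>h \<in> hom C W X. f \<cdot> g = f \<cdot> h \<longrightarrow> g = h)"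

definition epic :: "'o \<Rightarrow> 'o \<Rightarrow> 'm \<Rightarrow> bool" where
  "epic X Y f \<longleftrightarrow> f \<in> hom C X Y \<and>
     (\<forall>Z. \<forall>g \<in> hom C Y Z. \<forall>h \<in> hom C Y Z. g \<cdot> f = h \<cdot> f \<longrightarrow> g = h)"

text \<open>\<open>is_kernel K X Y k f\<close>: the morphism \<open>k : K \<rightarrow> X\<close> is a kernel of \<open>f : X \<rightarrow> Y\<close>;
  \<open>is_cokernel X Y Q q f\<close>: the morphism \<open>q : Y \<rightarrow> Q\<close> is a cokernel of \<open>f : X \<rightarrow> Y\<close>.\<close>

definition is_kernel :: "'o \<Rightarrow> 'o \<Rightarrow> 'o \<Rightarrow> 'm \<Rightarrow> 'm \<Rightarrow> bool" where
  "is_kernel K X Y k f \<longleftrightarrow> k \<in> hom C K X \<and> f \<in> hom C X Y \<and> f \<cdot> k = 0 \<and>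
     (\<forall>W. \<forall>h \<in> hom C W X. f \<cdot> h = 0 \<longrightarrow> (\<exists>!u. u \<in> hom C W K \<and> k \<cdot> u = h))"

definition is_cokernel :: "'o \<Rightarrow> 'o \<Rightarrow> 'o \<Rightarrow> 'm \<Rightarrow> 'm \<Rightarrow> bool" where
  "is_cokernel X Y Q q f \<longleftrightarrow> q \<in> hom C Y Q \<and> f \<in> hom C X Y \<and> q \<cdot> f = 0 \<and>
     (\<forall>Z. \<forall>h \<in> hom C Y Z. h \<cdot> f = 0 \<longrightarrow> (\<exists>!u. u \<in> hom C Q Z \<and> u \<cdot> q = h))"

text \<open>\<open>X\<close> is the direct sum of \<open>Y 0, \<dots>, Y (n - 1)\<close> with inclusions \<open>q i\<close> and projections \<open>p i\<close>.
  For \<open>n = 0\<close> this says that \<open>X\<close> is a zero object.\<close>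

definition is_direct_sum ::
    "nat \<Rightarrow> (nat \<Rightarrow> 'o) \<Rightarrow> 'o \<Rightarrow> (nat \<Rightarrow> 'm) \<Rightarrow> (nat \<Rightarrow> 'm) \<Rightarrow> bool" where
  "is_direct_sum n Y X q p \<longleftrightarrow>
     (\<forall>i<n. q i \<in> hom C (Y i) X \<and> p i \<in> hom C X (Y i)) \<and>
     (\<forall>i<n. \<forall>j<n. p i \<cdot> q j = (if i = j then idm C (Y i) else 0)) \<and>
     (\<Sum>i<n. q i \<cdot> p i) = idm C X"

definition is_simple :: "'o \<Rightarrow> bool" where
  "is_simple X \<longleftrightarrow> idm C X \<noteq> 0 \<and> (\<forall>W f. monic W X f \<longrightarrow> f = 0 \<or> is_iso W X f)"

end

locale abelian_category = linear_category +
  assumes direct_sums: "\<exists>X q p. is_direct_sum C n F X q p"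
    and kernels: "f \<in> hom C X Y \<Longrightarrow> \<exists>K k. is_kernel C K X Y k f"
    and cokernels: "f \<in> hom C X Y \<Longrightarrow> \<exists>Q q. is_cokernel C X Y Q q f"
    and monic_is_kernel: "monic C X Y f \<Longrightarrow> \<exists>Z g. is_kernel C X Y Z f g"
    and epic_is_cokernel: "epic C X Y f \<Longrightarrow> \<exists>W g. is_cokernel C W X Y f g"


section \<open>Braided tensor categories with duals and balancing\<close>

record ('o, 'm) tensor_cat = "('o, 'm) linear_cat" +
  tens :: "'o \<Rightarrow> 'o \<Rightarrow> 'o"  (infixr "\<otimes>\<index>" 73)
  unit_obj :: 'o
  tensm :: "'m \<Rightarrow> 'm \<Rightarrow> 'm"  (infixr "\<star>\<index>" 72)

locale strict_tensor_category = abelian_category C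
  for C :: "('o, 'm :: ab_group_add, 'x) tensor_cat_scheme" (structure) +
  assumes tens_assoc: "(X \<otimes> Y) \<otimes> Z = X \<otimes> (Y \<otimes> Z)"
    and tens_unit_left: "unit_obj C \<otimes> X = X"
    and tens_unit_right: "X \<otimes> unit_obj C = X"
    and tensm_in_hom: "\<lbrakk>f \<in> hom C X Y; f' \<in> hom C X' Y'\<rbrakk>
          \<Longrightarrow> f \<star> f' \<in> hom C (X \<otimes> X') (Y \<otimes> Y')"
    and tensm_id: "idm C X \<star> idm C Y = idm C (X \<otimes> Y)"
    and tensm_cmp: "\<lbrakk>g \<in> hom C Y Z; f \<in> hom C X Y; g' \<in> hom C Y' Z'; f' \<in> hom C X' Y'\<rbrakk>
          \<Longrightarrow> (g \<cdot> f) \<star> (g' \<cdot> f') = (g \<star> g') \<cdot> (f \<star> f')"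
    and tensm_assoc: "\<lbrakk>f \<in> hom C X Y; f' \<in> hom C X' Y'; f'' \<in> hom C X'' Y''\<rbrakk>
          \<Longrightarrow> (f \<star> f') \<star> f'' = f \<star> (f' \<star> f'')"
    and tensm_unit_left: "f \<in> hom C X Y \<Longrightarrow> idm C (unit_obj C) \<star> f = f"
    and tensm_unit_right: "f \<in> hom C X Y \<Longrightarrow> f \<star> idm C (unit_obj C) = f"
    and tensm_add_left: "\<lbrakk>f \<in> hom C X Y; g \<in> hom C X Y; h \<in> hom C X' Y'\<rbrakk>
          \<Longrightarrow> (f + g) \<star> h = (f \<star> h) + (g \<star> h)"
    and tensm_add_right: "\<lbrakk>h \<in> hom C X' Y'; f \<in> hom C X Y; g \<in> hom C X Y\<rbrakk>
          \<Longrightarrow> h \<star> (f + g) = (h \<star> f) + (h \<star> g)"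
    and tensm_smult_left: "\<lbrakk>f \<in> hom C X Y; h \<in> hom C X' Y'\<rbrakk> \<Longrightarrow> (a \<odot> f) \<star> h = a \<odot> (f \<star> h)"
    and tensm_smult_right: "\<lbrakk>f \<in> hom C X Y; h \<in> hom C X' Y'\<rbrakk> \<Longrightarrow> f \<star> (a \<odot> h) = a \<odot> (f \<star> h)"

record ('o, 'm) balanced_cat = "('o, 'm) tensor_cat" +
  braid :: "'o \<Rightarrow> 'o \<Rightarrow> 'm"
  twist :: "'o \<Rightarrow> 'm"
  dual :: "'o \<Rightarrow> 'o"
  ev :: "'o \<Rightarrow> 'm"
  coev :: "'o \<Rightarrow> 'm"

locale braided_category = strict_tensor_category C
  for C :: "('o, 'm :: ab_group_add, 'x) balanced_cat_scheme" (structure) +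
  assumes braid_iso: "is_iso C (X \<otimes> Y) (Y \<otimes> X) (braid C X Y)"
    and braid_natural: "\<lbrakk>f \<in> hom C X X'; g \<in> hom C Y Y'\<rbrakk>
          \<Longrightarrow> braid C X' Y' \<cdot> (f \<star> g) = (g \<star> f) \<cdot> braid C X Y"
    and hexagon_right: "braid C X (Y \<otimes> Z) =
          (idm C Y \<star> braid C X Z) \<cdot> (braid C X Y \<star> idm C Z)"
    and hexagon_left: "braid C (X \<otimes> Y) Z =
          (braid C X Z \<star> idm C Y) \<cdot> (idm C X \<star> braid C Y Z)"

text \<open>Only left duals are required; in a braided category they are right duals as well, with
  evaluation and coevaluation composed with the braiding.\<close>

locale rigid_braided_category = braided_category +
  assumes ev_in_hom: "ev C X \<in> hom C (dual C X \<otimes> X) (unit_obj C)"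
    and coev_in_hom: "coev C X \<in> hom C (unit_obj C) (X \<otimes> dual C X)"
    and zigzag: "(idm C X \<star> ev C X) \<cdot> (coev C X \<star> idm C X) = idm C X"
    and zigzag_dual: "(ev C X \<star> idm C (dual C X)) \<cdot> (idm C (dual C X) \<star> coev C X) = idm C (dual C X)"

context
  fixes C :: "('o, 'm :: ab_group_add, 'x) balanced_cat_scheme" (structure)
begin

text \<open>The transpose \<open>dual Y \<rightarrow> dual X\<close> of \<open>f : X \<rightarrow> Y\<close>.\<close>

definition transp :: "'o \<Rightarrow> 'o \<Rightarrow> 'm \<Rightarrow> 'm" where
  "transp X Y f =
     (ev C Y \<star> idm C (dual C X)) \<cdot> (idm C (dual C Y) \<star> f \<star> idm C (dual C X))
       \<cdot> (idm C (dual C Y) \<star> coev C X)"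

text \<open>The identification of \<open>End(1)\<close> with the complex numbers.\<close>

definition scalar_of :: "'m \<Rightarrow> complex" where
  "scalar_of f = (THE a. f = a \<odot> idm C (unit_obj C))"

text \<open>The closure of \<open>f\<close> to an annulus: the right evaluation \<open>X \<otimes> dual X \<rightarrow> 1\<close> is obtained from
  the left one by means of the braiding and the balancing.\<close>

definition tr :: "'o \<Rightarrow> 'm \<Rightarrow> complex" where
  "tr X f = scalar_of
     (ev C X \<cdot> braid C X (dual C X) \<cdot> ((twist C X \<cdot> f) \<star> idm C (dual C X)) \<cdot> coev C X)"

definition qdim :: "'o \<Rightarrow> complex" where
  "qdim X = tr X (idm C X)"

definition S_val :: "'o \<Rightarrow> 'o \<Rightarrow> complex" where
  "S_val X Y = tr (X \<otimes> Y) (braid C Y X \<cdot> braid C X Y)"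

end

text \<open>
  The last assumption is the usual compatibility of a balancing with duality.  It makes the annulus
  closed on the left and the one closed on the right agree, so that there is one canonical trace.
  Without it, take the vector spaces graded by the group of order three with trivial braiding, and
  let the twist be a nontrivial character of the group: then \<open>dim(g)\<close> is the value of the character
  at \<open>g\<close>, the sum of the squares of the dimensions and all \<open>\<Sum>\<^sub>j dim(j) S\<^sub>j\<^sub>i\<close> vanish, but \<open>S\<close> has rank
  one, hence is not invertible.
\<close>

locale balanced_category = rigid_braided_category +
  assumes twist_iso: "is_iso C X X (twist C X)"
    and twist_natural: "f \<in> hom C X Y \<Longrightarrow> twist C Y \<cdot> f = f \<cdot> twist C X"
    and twist_tens: "twist C (X \<otimes> Y) = braid C Y X \<cdot> braid C X Y \<cdot> (twist C X \<star> twist C Y)"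
    and twist_dual: "twist C (dual C X) = transp C X X (twist C X)"


section \<open>Semisimplicity\<close>

text \<open>The representatives of the isomorphism classes of simple objects are the objects \<open>rep i\<close>,
  with \<open>i\<close> in a finite index type; \<open>u\<close> is the index of the unit object.\<close>

locale semisimple_category = balanced_category C
  for C :: "('o, 'm :: ab_group_add, 'x) balanced_cat_scheme" (structure)
    and rep :: "'i :: finite \<Rightarrow> 'o" and u :: 'i +
  assumes semisimple: "\<exists>n F q p. (\<forall>i<n. is_simple C (F i)) \<and> is_direct_sum C n F X q p"
    and rep_simple: "is_simple C (rep i)"
    and rep_unique: "is_simple C X \<Longrightarrow> \<exists>!i. isomorphic C X (rep i)"
    and rep_unit: "rep u = unit_obj C"
    and rep_End: "hom C (rep i) (rep i) = range (\<lambda>a. a \<odot> idm C (rep i))"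
    and rep_dim: "qdim C (rep i) \<noteq> 0"

lemma (in linear_category) iso_idempotent:
  assumes "is_iso C X X f" "f \<cdot> f = f"
  shows "f = idm C X"
proof -
  from assms(1) obtain g where f: "f \<in> hom C X X" and g: "g \<in> hom C X X" "g \<cdot> f = idm C X"
    by (auto simp: is_iso_def)
  have "f = (g \<cdot> f) \<cdot> f" using f g cmp_id_left by simp
  also have "\<dots> = g \<cdot> (f \<cdot> f)" by (rule cmp_assoc[OF g(1) f f])
  finally show ?thesis using assms(2) g(2) by simp
qed

lemma (in braided_category) braid_in_hom: "braid C X Y \<in> hom C (X \<otimes> Y) (Y \<otimes> X)"
  using braid_iso by (simp add: is_iso_def)

lemma (in braided_category) braid_unit_right: "braid C X (unit_obj C) = idm C X"
proof (rule iso_idempotent)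
  show "is_iso C X X (braid C X (unit_obj C))"
    using braid_iso[of X "unit_obj C"] by (simp add: tens_unit_left tens_unit_right)
  have "braid C X (unit_obj C) \<in> hom C X X"
    using braid_in_hom[of X "unit_obj C"] by (simp add: tens_unit_left tens_unit_right)
  then show "braid C X (unit_obj C) \<cdot> braid C X (unit_obj C) = braid C X (unit_obj C)"
    using hexagon_right[of X "unit_obj C" "unit_obj C"]
    by (simp add: tens_unit_left tensm_unit_left tensm_unit_right)
qed

lemma (in braided_category) braid_unit_left: "braid C (unit_obj C) X = idm C X"
proof (rule iso_idempotent)
  show "is_iso C X X (braid C (unit_obj C) X)"
    using braid_iso[of "unit_obj C" X] by (simp add: tens_unit_left tens_unit_right)
  have "braid C (unit_obj C) X \<in> hom C X X"
    using braid_in_hom[of "unit_obj C" X] by (simp add: tens_unit_left tens_unit_right)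
  then show "braid C (unit_obj C) X \<cdot> braid C (unit_obj C) X = braid C (unit_obj C) X"
    using hexagon_left[of "unit_obj C" "unit_obj C" X]
    by (simp add: tens_unit_left tensm_unit_left tensm_unit_right)
qed

lemma (in braided_category) S_val_unit: "S_val C (unit_obj C) X = qdim C X"
  using cmp_id_left[OF id_in_hom, of X]
  by (simp add: S_val_def qdim_def braid_unit_left braid_unit_right tens_unit_left)

lemma (in semisimple_category) tr_wellformed:
  assumes f: "f \<in> hom C X X"
  shows "ev C X \<cdot> braid C X (dual C X) \<cdot> ((twist C X \<cdot> f) \<star> idm C (dual C X)) \<cdot> coev C X
           = tr C X f \<odot> idm C (unit_obj C)" (is "?t = _")
proof -
  have "twist C X \<in> hom C X X" using twist_iso by (simp add: is_iso_def)
  then have "?t \<in> hom C (unit_obj C) (unit_obj C)"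
    by (intro cmp_in_hom[OF ev_in_hom] cmp_in_hom[OF braid_in_hom] cmp_in_hom[OF _ coev_in_hom]
        tensm_in_hom cmp_in_hom[OF _ f] id_in_hom)
  then obtain a where a: "?t = a \<odot> idm C (unit_obj C)"
    using rep_End[of u] by (auto simp: rep_unit)
  have "idm C (unit_obj C) \<noteq> 0" using rep_simple[of u] by (simp add: rep_unit is_simple_def)
  then have "scalar_of C ?t = a" unfolding a scalar_of_def
    by (intro the_equality) (auto dest: scale_right_imp_eq)
  then show ?thesis by (simp add: tr_def a)
qed

definition S_matrix ::
    "('o, 'm :: ab_group_add, 'x) balanced_cat_scheme \<Rightarrow> ('i :: finite \<Rightarrow> 'o) \<Rightarrow> complex ^ 'i ^ 'i" where
  "S_matrix C rep = (\<chi> i j. S_val C (rep i) (rep j))"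

definition global_dim ::
    "('o, 'm :: ab_group_add, 'x) balanced_cat_scheme \<Rightarrow> ('i :: finite \<Rightarrow> 'o) \<Rightarrow> complex" where
  "global_dim C rep = (\<Sum>j\<in>UNIV. (qdim C (rep j))\<^sup>2)"

end

theory Submission
  imports Defs
begin

text \<open>
  For a simple object \<open>i\<close>, closing a strand \<open>Y\<close> around the strand \<open>i\<close> gives an endomorphism of \<open>i\<close>,
  hence the scalar \<open>S(i, Y) / dim(i)\<close>.  Encircling by \<open>Y \<otimes> Z\<close> is encircling twice, and encircling by a
  direct sum adds up, so \<open>\<chi>\<^sub>i(Y) = S(i, Y) / dim(i)\<close> is a character of the fusion ring
  (\<open>S_val_tens\<close>, \<open>S_val_fusion\<close>); for the unit object this is the dimension.  Everything else is
  linear algebra with these characters.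

  Let \<open>N(k, j, m)\<close> be the multiplicity of \<open>m\<close> in \<open>k \<otimes> j\<close>.  Duality turns \<open>Hom(k \<otimes> j, m)\<close> into
  \<open>Hom(j, k* \<otimes> m)\<close>, so \<open>N(k, j, m) = N(k*, m, j)\<close> (\<open>frobenius_reciprocity\<close>): on functions of \<open>j\<close>,
  multiplication by \<open>k*\<close> is the adjoint of multiplication by \<open>k\<close>.  Characters are common
  eigenvectors of these operators, which gives the usual two consequences
  (\<open>character_sum_shift\<close>).  Comparing the dimension with itself, the conjugate of \<open>dim(k)\<close> is
  \<open>dim(k*) = dim(k)\<close>; the dimensions are real, and \<open>\<D>\<^sup>2\<close> is a sum of squares of nonzero real
  numbers, hence nonzero.  Comparing the dimension with \<open>\<chi>\<^sub>i\<close>, either they agree or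
  \<open>\<Sum>\<^sub>j dim(j) S(i, j) = 0\<close>.

  If a vector \<open>v\<close> is mapped by \<open>S\<close> to the unit vector, then for \<open>i\<close> not the unit \<open>\<chi>\<^sub>i\<close> kills \<open>v\<close> and
  the dimension does not; the two characters differ, so the vector of dimensions is mapped to
  \<open>\<D>\<^sup>2\<close> times the unit vector.  In that case
  \<open>\<Sum>\<^sub>j S(j, i) S(j, k) = \<Sum>\<^sub>m N(i, k, m) \<Sum>\<^sub>j dim(j) S(j, m) = \<D>\<^sup>2 N(i, k, 1)\<close>, and \<open>N(i, k, 1)\<close> is the
  permutation matrix of the duality of simple objects; as \<open>\<D>\<^sup>2 \<noteq> 0\<close>, \<open>S\<close> is invertible.  Finally an
  invertible matrix has every vector in its image.

  The topological input consists of a few facts about the trace: it does not depend on the chosen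
  dual and is cyclic (\<open>dual_trace_cyclic\<close>), the trace over \<open>X \<otimes> Y\<close> can be taken first over \<open>Y\<close>
  (\<open>Tr_partial_trace\<close>), and dual objects have equal dimensions (\<open>Tr_dual_id\<close>).
\<close>

section \<open>A calculus of whiskered arrows\<close>

text \<open>
  A morphism lies in a morphism space only by a side condition, and the spaces may overlap.  Keeping
  source and target with a morphism makes them computable by rewriting.  All diagrams below are
  composites of generators with identity strands to the left and right.
\<close>

datatype ('o, 'm) arrow = Arrow (src: 'o) (tgt: 'o) (mor: 'm)

context strict_tensor_category
begin

abbreviation one :: 'o where "one \<equiv> unit_obj C"

definition wf :: "('o, 'm) arrow \<Rightarrow> bool" where
  "wf f \<longleftrightarrow> mor f \<in> hom C (src f) (tgt f)"

definition comp :: "('o, 'm) arrow \<Rightarrow> ('o, 'm) arrow \<Rightarrow> ('o, 'm) arrow" (infixr "\<diamondop>" 60) where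
  "g \<diamondop> f = Arrow (src f) (tgt g) (mor g \<cdot> mor f)"

definition Id :: "'o \<Rightarrow> ('o, 'm) arrow" where
  "Id X = Arrow X X (idm C X)"

definition whisker :: "'o \<Rightarrow> ('o, 'm) arrow \<Rightarrow> 'o \<Rightarrow> ('o, 'm) arrow" where
  "whisker L f R = Arrow (L \<otimes> src f \<otimes> R) (L \<otimes> tgt f \<otimes> R) (idm C L \<star> mor f \<star> idm C R)"

declare tens_assoc [simp] tens_unit_left [simp] tens_unit_right [simp]

lemma src_simps [simp]: "src (g \<diamondop> f) = src f" "src (Id X) = X" "src (whisker L f R) = L \<otimes> src f \<otimes> R"
  and tgt_simps [simp]: "tgt (g \<diamondop> f) = tgt g" "tgt (Id X) = X" "tgt (whisker L f R) = L \<otimes> tgt f \<otimes> R"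
  by (simp_all add: comp_def Id_def whisker_def)

lemma wf_comp [simp]: "\<lbrakk>wf g; wf f; tgt f = src g\<rbrakk> \<Longrightarrow> wf (g \<diamondop> f)"
  by (auto simp: wf_def comp_def intro: cmp_in_hom)

lemma wf_Id [simp]: "wf (Id X)"
  by (simp add: wf_def Id_def id_in_hom)

lemma wf_whisker [simp]: "wf f \<Longrightarrow> wf (whisker L f R)"
  by (auto simp: wf_def whisker_def intro: tensm_in_hom id_in_hom)

lemma comp_assoc: "\<lbrakk>wf h; wf g; wf f; tgt f = src g; tgt g = src h\<rbrakk> \<Longrightarrow> (h \<diamondop> g) \<diamondop> f = h \<diamondop> g \<diamondop> f"
  by (auto simp: wf_def comp_def intro: cmp_assoc)

lemma comp_Id_left [simp]: "\<lbrakk>wf f; tgt f = X\<rbrakk> \<Longrightarrow> Id X \<diamondop> f = f"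
  by (cases f) (auto simp: wf_def comp_def Id_def cmp_id_left)

lemma comp_Id_right [simp]: "\<lbrakk>wf f; src f = X\<rbrakk> \<Longrightarrow> f \<diamondop> Id X = f"
  by (cases f) (auto simp: wf_def comp_def Id_def cmp_id_right)

lemma whisker_comp:
  assumes "wf g" "wf f" "tgt f = src g"
  shows "whisker L (g \<diamondop> f) R = whisker L g R \<diamondop> whisker L f R"
proof -
  note i = id_in_hom
  have f: "mor f \<in> hom C (src f) (src g)" and g: "mor g \<in> hom C (src g) (tgt g)"
    using assms by (simp_all add: wf_def)
  have "(mor g \<cdot> mor f) \<star> idm C R = (mor g \<star> idm C R) \<cdot> (mor f \<star> idm C R)"
    using tensm_cmp[OF g f i i] by (simp add: cmp_id_left[OF i])
  moreover have "idm C L \<star> ((mor g \<star> idm C R) \<cdot> (mor f \<star> idm C R))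
      = (idm C L \<star> mor g \<star> idm C R) \<cdot> (idm C L \<star> mor f \<star> idm C R)"
    using tensm_cmp[OF i i tensm_in_hom[OF g i] tensm_in_hom[OF f i]] by (simp add: cmp_id_left[OF i])
  ultimately show ?thesis by (simp add: whisker_def comp_def)
qed

lemma whisker_whisker: "wf f \<Longrightarrow> whisker L (whisker L' f R') R = whisker (L \<otimes> L') f (R' \<otimes> R)"
proof -
  assume f: "wf f"
  then have f': "mor f \<in> hom C (src f) (tgt f)" by (simp add: wf_def)
  note i = id_in_hom
  have "idm C L \<star> (idm C L' \<star> mor f \<star> idm C R') \<star> idm C R
      = idm C L \<star> idm C L' \<star> (mor f \<star> idm C R') \<star> idm C R"
    by (simp add: tensm_assoc[OF i tensm_in_hom[OF f' i] i])
  also have "\<dots> = idm C L \<star> idm C L' \<star> mor f \<star> idm C (R' \<otimes> R)"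
    by (simp add: tensm_assoc[OF f' i i] tensm_id)
  also have "\<dots> = idm C (L \<otimes> L') \<star> mor f \<star> idm C (R' \<otimes> R)"
    using tensm_assoc[OF i i tensm_in_hom[OF f' i], of L L' "R' \<otimes> R"]
    by (simp add: tensm_id)
  finally show ?thesis using f by (simp add: whisker_def)
qed

lemma whisker_unit [simp]: "wf f \<Longrightarrow> whisker one f one = f"
  by (cases f) (auto simp: whisker_def wf_def tensm_unit_left tensm_unit_right)

lemma whisker_Id [simp]: "whisker L (Id X) R = Id (L \<otimes> X \<otimes> R)"
  by (simp add: whisker_def Id_def tensm_id)

lemmas flat = whisker_comp whisker_whisker comp_assoc

text \<open>
  The only relation between generators at disjoint places of a diagram.  Together with \<open>flat\<close>, which
  writes a diagram as a composite of whiskered generators, it replaces the tensor product of morphisms.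
\<close>

lemma interchange:
  assumes f: "wf f" and g: "wf g"
  shows "whisker L f (M \<otimes> tgt g \<otimes> R) \<diamondop> whisker (L \<otimes> src f \<otimes> M) g R
       = whisker (L \<otimes> tgt f \<otimes> M) g R \<diamondop> whisker L f (M \<otimes> src g \<otimes> R)"
proof -
  have basic: "whisker one f (tgt k) \<diamondop> whisker (src f) k one
      = whisker (tgt f) k one \<diamondop> whisker one f (src k)"
    if "wf k" for k
  proof -
    have f': "mor f \<in> hom C (src f) (tgt f)" and k: "mor k \<in> hom C (src k) (tgt k)"
      using f that by (simp_all add: wf_def)
    note i = id_in_hom
    have "(mor f \<star> idm C (tgt k)) \<cdot> (idm C (src f) \<star> mor k) = mor f \<star> mor k"
      by (simp add: tensm_cmp[OF f' i i k, symmetric] cmp_id_left[OF k] cmp_id_right[OF f'])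
    moreover have "(idm C (tgt f) \<star> mor k) \<cdot> (mor f \<star> idm C (src k)) = mor f \<star> mor k"
      by (simp add: tensm_cmp[OF i f' k i, symmetric] cmp_id_right[OF k] cmp_id_left[OF f'])
    ultimately show ?thesis
      by (simp add: whisker_def comp_def tensm_unit_left[OF tensm_in_hom[OF f' i]] tensm_unit_right[OF k])
  qed
  have "whisker L (whisker one f (tgt (whisker M g one)) \<diamondop> whisker (src f) (whisker M g one) one) R
      = whisker L (whisker (tgt f) (whisker M g one) one \<diamondop> whisker one f (src (whisker M g one))) R"
    using basic[of "whisker M g one"] g by simp
  then show ?thesis using f g by (simp add: flat)
qed

text \<open>
  Composites are associated to the right, so a relation between adjacent factors has to be
  rewritten in front of the remaining ones.
\<close>

lemma comp_cong22:
  "\<lbrakk>a \<diamondop> b = c \<diamondop> d; wf a; wf b; wf c; wf d; tgt b = src a; tgt d = src c; wf x; tgt x = src b\<rbrakk>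
   \<Longrightarrow> a \<diamondop> b \<diamondop> x = c \<diamondop> d \<diamondop> x"
  by (metis comp_assoc src_simps(1))

lemma comp_cong21:
  "\<lbrakk>a \<diamondop> b = c; wf a; wf b; tgt b = src a; wf x; tgt x = src b\<rbrakk> \<Longrightarrow> a \<diamondop> b \<diamondop> x = c \<diamondop> x"
  by (metis comp_assoc)

text \<open>
  The chosen dual of \<open>X \<otimes> Y\<close> and the double dual of \<open>X\<close> are unrelated to the duals of \<open>X\<close> and \<open>Y\<close>.
  Therefore arbitrary duality data are admitted in place of the chosen ones.
\<close>

definition dual_pair :: "'o \<Rightarrow> 'o \<Rightarrow> ('o, 'm) arrow \<Rightarrow> ('o, 'm) arrow \<Rightarrow> bool" where
  "dual_pair X D e n \<longleftrightarrow> wf e \<and> src e = D \<otimes> X \<and> tgt e = one \<and> wf n \<and> src n = one \<and> tgt n = X \<otimes> D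
     \<and> whisker X e one \<diamondop> whisker one n X = Id X \<and> whisker one e D \<diamondop> whisker D n one = Id D"

lemma dual_pairD:
  assumes "dual_pair X D e n"
  shows "wf e" "src e = D \<otimes> X" "tgt e = one" "wf n" "src n = one" "tgt n = X \<otimes> D"
    "whisker X e one \<diamondop> whisker one n X = Id X" "whisker one e D \<diamondop> whisker D n one = Id D"
  using assms by (simp_all add: dual_pair_def)

text \<open>
  The mate of \<open>f\<close> is its transpose with respect to two dualities: \<open>f\<close> can be pulled along a cap or a cup
  to the other strand.  For \<open>f\<close> the identity this compares two duals of one object; the formula for
  \<open>m\<close> identifies the twist of a dual object as the mate of the twist.
\<close>

lemma mate_exists:
  assumes X: "dual_pair X D e n" and Y: "dual_pair Y D' e' n'"
    and f: "wf f" "src f = X" "tgt f = Y"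
  obtains m where "m = whisker one e' D \<diamondop> whisker D' f D \<diamondop> whisker D' n one"
    "wf m" "src m = D'" "tgt m = D"
    "whisker one f D \<diamondop> n = whisker Y m one \<diamondop> n'" "e \<diamondop> whisker one m X = e' \<diamondop> whisker D' f one"
proof
  note [simp] = dual_pairD(1-6)[OF X] dual_pairD(1-6)[OF Y] f
  define m where "m = whisker one e' D \<diamondop> whisker D' f D \<diamondop> whisker D' n one"
  show "m = whisker one e' D \<diamondop> whisker D' f D \<diamondop> whisker D' n one" by (fact m_def)
  show "wf m" "src m = D'" "tgt m = D" by (simp_all add: m_def)
  have z: "whisker Y e' D \<diamondop> whisker one n' (Y \<otimes> D) = Id (Y \<otimes> D)"
    using arg_cong[OF dual_pairD(7)[OF Y], of "\<lambda>x. whisker one x D"] by (simp add: flat)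
  have 1: "whisker (Y \<otimes> D') n one \<diamondop> n' = whisker one n' (X \<otimes> D) \<diamondop> n"
    using interchange[of n' n one one one] by simp
  have 2: "whisker (Y \<otimes> D') f D \<diamondop> whisker one n' (X \<otimes> D) = whisker one n' (Y \<otimes> D) \<diamondop> whisker one f D"
    using interchange[of n' f one one D] by simp
  have "whisker Y m one \<diamondop> n' = whisker Y e' D \<diamondop> whisker (Y \<otimes> D') f D \<diamondop> whisker (Y \<otimes> D') n one \<diamondop> n'"
    by (simp add: m_def flat)
  also have "\<dots> = whisker Y e' D \<diamondop> whisker one n' (Y \<otimes> D) \<diamondop> whisker one f D \<diamondop> n"
    by (simp add: 1 comp_cong22[OF 2])
  also have "\<dots> = whisker one f D \<diamondop> n"
    by (simp add: comp_cong21[OF z])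
  finally show "whisker one f D \<diamondop> n = whisker Y m one \<diamondop> n'" by simp
  have z: "whisker (D' \<otimes> X) e one \<diamondop> whisker D' n X = Id (D' \<otimes> X)"
    using arg_cong[OF dual_pairD(7)[OF X], of "\<lambda>x. whisker D' x one"] by (simp add: flat)
  have 1: "e \<diamondop> whisker one e' (D \<otimes> X) = e' \<diamondop> whisker (D' \<otimes> Y) e one"
    using interchange[of e' e one one one] by simp
  have 2: "whisker (D' \<otimes> Y) e one \<diamondop> whisker D' f (D \<otimes> X)
      = whisker D' f one \<diamondop> whisker (D' \<otimes> X) e one"
    using interchange[of f e D' one one] by simp
  have "e \<diamondop> whisker one m X = e \<diamondop> whisker one e' (D \<otimes> X) \<diamondop> whisker D' f (D \<otimes> X) \<diamondop> whisker D' n X"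
    by (simp add: m_def flat)
  also have "\<dots> = e' \<diamondop> whisker D' f one \<diamondop> whisker (D' \<otimes> X) e one \<diamondop> whisker D' n X"
    by (simp add: comp_cong22[OF 1] comp_cong22[OF 2])
  also have "\<dots> = e' \<diamondop> whisker D' f one"
    by (simp add: z)
  finally show "e \<diamondop> whisker one m X = e' \<diamondop> whisker D' f one" .
qed

lemma dual_pair_tens:
  assumes X: "dual_pair X D e n" and Y: "dual_pair Y D' e' n'"
  shows "dual_pair (X \<otimes> Y) (D' \<otimes> D) (e' \<diamondop> whisker D' e Y) (whisker X n' D \<diamondop> n)"
proof -
  note [simp] = dual_pairD(1-6)[OF X] dual_pairD(1-6)[OF Y]
  have zX: "whisker X e Y \<diamondop> whisker one n (X \<otimes> Y) = Id (X \<otimes> Y)"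
    using arg_cong[OF dual_pairD(7)[OF X], of "\<lambda>x. whisker one x Y"] by (simp add: flat)
  have zY: "whisker (X \<otimes> Y) e' one \<diamondop> whisker X n' Y = Id (X \<otimes> Y)"
    using arg_cong[OF dual_pairD(7)[OF Y], of "\<lambda>x. whisker X x one"] by (simp add: flat)
  have zX': "whisker D' e D \<diamondop> whisker (D' \<otimes> D) n one = Id (D' \<otimes> D)"
    using arg_cong[OF dual_pairD(8)[OF X], of "\<lambda>x. whisker D' x one"] by (simp add: flat)
  have zY': "whisker one e' (D' \<otimes> D) \<diamondop> whisker D' n' D = Id (D' \<otimes> D)"
    using arg_cong[OF dual_pairD(8)[OF Y], of "\<lambda>x. whisker one x D"] by (simp add: flat)
  have i1: "whisker (X \<otimes> Y \<otimes> D') e Y \<diamondop> whisker X n' (D \<otimes> X \<otimes> Y) = whisker X n' Y \<diamondop> whisker X e Y"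
    using interchange[of n' e X one Y] by simp
  have i2: "whisker D' e (Y \<otimes> D' \<otimes> D) \<diamondop> whisker (D' \<otimes> D \<otimes> X) n' D
      = whisker D' n' D \<diamondop> whisker D' e D"
    using interchange[of e n' D' one D] by simp
  have "whisker (X \<otimes> Y) (e' \<diamondop> whisker D' e Y) one \<diamondop> whisker one (whisker X n' D \<diamondop> n) (X \<otimes> Y)
     = whisker (X \<otimes> Y) e' one \<diamondop> whisker (X \<otimes> Y \<otimes> D') e Y \<diamondop> whisker X n' (D \<otimes> X \<otimes> Y)
     \<diamondop> whisker one n (X \<otimes> Y)"
    by (simp add: flat)
  also have "\<dots> = Id (X \<otimes> Y)"
    by (simp add: comp_cong22[OF i1] zX zY)
  finally have 1: "whisker (X \<otimes> Y) (e' \<diamondop> whisker D' e Y) one \<diamondop> whisker one (whisker X n' D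
      \<diamondop> n) (X \<otimes> Y) = Id (X \<otimes> Y)" .
  have "whisker one (e' \<diamondop> whisker D' e Y) (D' \<otimes> D) \<diamondop> whisker (D' \<otimes> D) (whisker X n' D \<diamondop> n) one
     = whisker one e' (D' \<otimes> D) \<diamondop> whisker D' e (Y \<otimes> D' \<otimes> D) \<diamondop> whisker (D' \<otimes> D \<otimes> X) n' D
     \<diamondop> whisker (D' \<otimes> D) n one"
    by (simp add: flat)
  also have "\<dots>
      = whisker one e' (D' \<otimes> D) \<diamondop> whisker D' n' D \<diamondop> whisker D' e D \<diamondop> whisker (D' \<otimes> D) n one"
    by (simp add: comp_cong22[OF i2])
  also have "\<dots> = Id (D' \<otimes> D)"
    by (simp add: comp_cong21[OF zY'] zX' zY')
  finally show ?thesis using 1 by (simp add: dual_pair_def)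
qed

section \<open>Scalars and bending of strands\<close>

definition scal :: "complex \<Rightarrow> ('o, 'm) arrow \<Rightarrow> ('o, 'm) arrow" where
  "scal a f = Arrow (src f) (tgt f) (a \<odot> mor f)"

lemma scal_simps [simp]: "src (scal a f) = src f" "tgt (scal a f) = tgt f" "mor (scal a f) = a \<odot> mor f"
  by (simp_all add: scal_def)

lemma wf_scal [simp]: "wf f \<Longrightarrow> wf (scal a f)"
  using subspace_scale[OF hom_subspace] by (simp add: wf_def)

lemma comp_scal_left: "\<lbrakk>wf g; wf f; tgt f = src g\<rbrakk> \<Longrightarrow> scal a g \<diamondop> f = scal a (g \<diamondop> f)"
  by (auto simp: scal_def comp_def wf_def cmp_smult_left)

lemma comp_scal_right: "\<lbrakk>wf g; wf f; tgt f = src g\<rbrakk> \<Longrightarrow> g \<diamondop> scal a f = scal a (g \<diamondop> f)"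
  by (auto simp: scal_def comp_def wf_def cmp_smult_right)

lemma whisker_scal: "wf f \<Longrightarrow> whisker L (scal a f) R = scal a (whisker L f R)"
  by (auto simp: scal_def whisker_def wf_def tensm_smult_left[OF _ id_in_hom]
      tensm_smult_right[OF id_in_hom tensm_in_hom[OF _ id_in_hom]])

text \<open>
  Bending the strand \<open>D\<close> up and bending it back down straightens by the zigzag equations.
\<close>

lemma duality_adjunction:
  assumes X: "dual_pair X D e n"
  shows "bij_betw (\<lambda>f. (idm C X \<star> f) \<cdot> (mor n \<star> idm C A)) (hom C (D \<otimes> A) Y) (hom C A (X \<otimes> Y))"
proof (rule bij_betw_byWitness[where f' = "\<lambda>g. (mor e \<star> idm C Y) \<cdot> (idm C D \<star> g)"])
  note [simp] = dual_pairD(1-6)[OF X]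
  note i = id_in_hom
  have L: "(idm C X \<star> f) \<cdot> (mor n \<star> idm C A)
      = mor (whisker X (Arrow (D \<otimes> A) Y f) one \<diamondop> whisker one n A)"
    if "f \<in> hom C (D \<otimes> A) Y" for f
    using dual_pairD(4-6)[OF X]
    by (auto simp: comp_def whisker_def wf_def tensm_unit_right[OF that]
      intro!: arg_cong2[where f = "cmp C"] tensm_unit_left[symmetric] tensm_in_hom i)
  have R: "(mor e \<star> idm C Y) \<cdot> (idm C D \<star> g)
      = mor (whisker one e Y \<diamondop> whisker D (Arrow A (X \<otimes> Y) g) one)"
    if "g \<in> hom C A (X \<otimes> Y)" for g
    using dual_pairD(1-3)[OF X]
    by (auto simp: comp_def whisker_def wf_def tensm_unit_right[OF that]
      intro!: arg_cong2[where f = "cmp C"] tensm_unit_left[symmetric] tensm_in_hom i)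
  show L_in: "(\<lambda>f. (idm C X \<star> f) \<cdot> (mor n \<star> idm C A)) ` hom C (D \<otimes> A) Y \<subseteq> hom C A (X \<otimes> Y)"
  proof safe
    fix f assume f: "f \<in> hom C (D \<otimes> A) Y"
    have "wf (whisker X (Arrow (D \<otimes> A) Y f) one
        \<diamondop> whisker one n A)" using f by (simp add: wf_def[of "Arrow _ _ _"])
    then show "(idm C X \<star> f) \<cdot> (mor n \<star> idm C A) \<in> hom C A (X \<otimes> Y)"
      unfolding L[OF f] by (simp add: wf_def)
  qed
  show R_in: "(\<lambda>g. (mor e \<star> idm C Y) \<cdot> (idm C D \<star> g)) ` hom C A (X \<otimes> Y) \<subseteq> hom C (D \<otimes> A) Y"
  proof safe
    fix g assume g: "g \<in> hom C A (X \<otimes> Y)"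
    have "wf (whisker one e Y
        \<diamondop> whisker D (Arrow A (X \<otimes> Y) g) one)" using g by (simp add: wf_def[of "Arrow _ _ _"])
    then show "(mor e \<star> idm C Y) \<cdot> (idm C D \<star> g) \<in> hom C (D \<otimes> A) Y"
      unfolding R[OF g] by (simp add: wf_def)
  qed
  show "\<forall>f\<in>hom C (D \<otimes> A) Y. (mor e \<star> idm C Y) \<cdot> (idm C D \<star> ((idm C X \<star> f) \<cdot> (mor n \<star> idm C A))) = f"
  proof
    fix f assume f: "f \<in> hom C (D \<otimes> A) Y"
    define F where "F = Arrow (D \<otimes> A) Y f"
    have [simp]: "wf F" "src F = D \<otimes> A" "tgt F = Y" using f by (simp_all add: F_def wf_def)
    define G where "G = whisker X F one \<diamondop> whisker one n A"
    have G: "Arrow A (X \<otimes> Y) ((idm C X \<star> f) \<cdot> (mor n \<star> idm C A)) = G"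
      by (rule arrow.expand) (simp add: G_def L[OF f] flip: F_def)
    have 1: "whisker one e Y \<diamondop> whisker (D \<otimes> X) F one = F \<diamondop> whisker one e (D \<otimes> A)"
      using interchange[of e F one one one] by simp
    have 2: "whisker one e (D \<otimes> A) \<diamondop> whisker D n A = Id (D \<otimes> A)"
      using arg_cong[OF dual_pairD(8)[OF X], of "\<lambda>x. whisker one x A"] by (simp add: flat)
    have "whisker one e Y \<diamondop> whisker D G one = F"
      by (simp add: G_def flat comp_cong22[OF 1] 2)
    then have "mor (whisker one e Y \<diamondop> whisker D G one) = f" by (simp add: F_def)
    then show "(mor e \<star> idm C Y) \<cdot> (idm C D \<star> ((idm C X \<star> f) \<cdot> (mor n \<star> idm C A))) = f"
      using L_in f by (subst R) (auto simp only: G)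
  qed
  show "\<forall>g\<in>hom C A (X \<otimes> Y). (idm C X \<star> ((mor e \<star> idm C Y) \<cdot> (idm C D \<star> g))) \<cdot> (mor n \<star> idm C A) = g"
  proof
    fix g assume g: "g \<in> hom C A (X \<otimes> Y)"
    define G where "G = Arrow A (X \<otimes> Y) g"
    have [simp]: "wf G" "src G = A" "tgt G = X \<otimes> Y" using g by (simp_all add: G_def wf_def)
    define F where "F = whisker one e Y \<diamondop> whisker D G one"
    have F: "Arrow (D \<otimes> A) Y ((mor e \<star> idm C Y) \<cdot> (idm C D \<star> g)) = F"
      by (rule arrow.expand) (simp add: F_def R[OF g] flip: G_def)
    have 1: "whisker (X \<otimes> D) G one \<diamondop> whisker one n A = whisker one n (X \<otimes> Y) \<diamondop> G"
      using interchange[of n G one one one] by simp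
    have 2: "whisker X e Y \<diamondop> whisker one n (X \<otimes> Y) = Id (X \<otimes> Y)"
      using arg_cong[OF dual_pairD(7)[OF X], of "\<lambda>x. whisker one x Y"] by (simp add: flat)
    have "whisker X F one \<diamondop> whisker one n A = G"
      by (simp add: F_def flat 1 comp_cong21[OF 2])
    then have "mor (whisker X F one \<diamondop> whisker one n A) = g" by (simp add: G_def)
    then show "(idm C X \<star> ((mor e \<star> idm C Y) \<cdot> (idm C D \<star> g))) \<cdot> (mor n \<star> idm C A) = g"
      using R_in g by (subst L) (auto simp only: F)
  qed
qed

end

section \<open>Braiding and duality\<close>

context braided_category
begin

definition Braid :: "'o \<Rightarrow> 'o \<Rightarrow> ('o, 'm) arrow" where
  "Braid X Y = Arrow (X \<otimes> Y) (Y \<otimes> X) (braid C X Y)"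

lemma Braid_simps [simp]: "src (Braid X Y) = X \<otimes> Y" "tgt (Braid X Y) = Y \<otimes> X" "wf (Braid X Y)"
  by (simp_all add: Braid_def wf_def braid_in_hom)

lemma Braid_inverse:
  obtains c where "wf c" "src c = Y \<otimes> X" "tgt c = X \<otimes> Y"
    "c \<diamondop> Braid X Y = Id (X \<otimes> Y)" "Braid X Y \<diamondop> c = Id (Y \<otimes> X)"
proof -
  obtain g where "g \<in> hom C (Y \<otimes> X) (X \<otimes> Y)" "g \<cdot> braid C X Y = idm C (X \<otimes> Y)"
    "braid C X Y \<cdot> g = idm C (Y \<otimes> X)"
    using braid_iso[of X Y] by (auto simp: is_iso_def)
  then show ?thesis
    by (intro that[of "Arrow (Y \<otimes> X) (X \<otimes> Y) g"]) (simp_all add: wf_def Braid_def comp_def Id_def)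
qed

lemma Braid_unit [simp]: "Braid one X = Id X" "Braid X one = Id X"
  by (simp_all add: Braid_def Id_def braid_unit_left braid_unit_right)

lemma Braid_natural_left:
  assumes "wf f"
  shows "Braid (tgt f) Y \<diamondop> whisker one f Y = whisker Y f one \<diamondop> Braid (src f) Y"
proof -
  have f: "mor f \<in> hom C (src f) (tgt f)" using assms by (simp add: wf_def)
  show ?thesis
    using braid_natural[OF f id_in_hom[of Y]]
    by (simp add: Braid_def comp_def whisker_def tensm_unit_left[OF tensm_in_hom[OF f id_in_hom]]
        tensm_unit_right[OF f])
qed

lemma Braid_natural_right:
  assumes "wf f"
  shows "Braid X (tgt f) \<diamondop> whisker X f one = whisker one f X \<diamondop> Braid X (src f)"
proof -
  have f: "mor f \<in> hom C (src f) (tgt f)" using assms by (simp add: wf_def)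
  show ?thesis
    using braid_natural[OF id_in_hom[of X] f]
    by (simp add: Braid_def comp_def whisker_def tensm_unit_left[OF tensm_in_hom[OF f id_in_hom]]
        tensm_unit_right[OF f])
qed

lemma Braid_tens_right: "Braid X (Y \<otimes> Z) = whisker Y (Braid X Z) one \<diamondop> whisker one (Braid X Y) Z"
  using hexagon_right[of X Y Z]
  by (simp add: Braid_def comp_def whisker_def tensm_unit_left[OF tensm_in_hom[OF braid_in_hom id_in_hom]]
      tensm_unit_right[OF braid_in_hom])

lemma Braid_tens_left: "Braid (X \<otimes> Y) Z = whisker one (Braid X Z) Y \<diamondop> whisker X (Braid Y Z) one"
  using hexagon_left[of X Y Z]
  by (simp add: Braid_def comp_def whisker_def tensm_unit_left[OF tensm_in_hom[OF braid_in_hom id_in_hom]]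
      tensm_unit_right[OF braid_in_hom])

text \<open>
  Move \<open>f\<close> around the annulus: its mate slides through the cup, the crossing and the cap.  With
  \<open>f\<close> an identity, the closure does not depend on the dual.
\<close>

lemma dual_trace_cyclic:
  assumes X: "dual_pair X D e n" and Y: "dual_pair Y D' e' n'"
    and f: "wf f" "src f = X" "tgt f = Y" and g: "wf g" "src g = Y" "tgt g = X"
  shows "e \<diamondop> Braid X D \<diamondop> whisker one (g \<diamondop> f) D \<diamondop> n = e' \<diamondop> Braid Y D' \<diamondop> whisker one (f \<diamondop> g) D' \<diamondop> n'"
proof -
  note [simp] = dual_pairD(1-6)[OF X] dual_pairD(1-6)[OF Y] f g
  obtain m where m [simp]: "wf m" "src m = D'" "tgt m = D"
    and m1: "whisker one f D \<diamondop> n = whisker Y m one \<diamondop> n'" and m2: "e \<diamondop> whisker one m X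
        = e' \<diamondop> whisker D' f one"
    using mate_exists[OF X Y f] by blast
  have g_m: "whisker one g D \<diamondop> whisker Y m one = whisker X m one \<diamondop> whisker one g D'"
    using interchange[of g m one one one] by simp
  have B_m: "Braid X D \<diamondop> whisker X m one = whisker one m X \<diamondop> Braid X D'"
    using Braid_natural_right[of m X] by simp
  have B_f: "whisker D' f one \<diamondop> Braid X D' = Braid Y D' \<diamondop> whisker one f D'"
    using Braid_natural_left[of f D'] by simp
  have "e \<diamondop> Braid X D \<diamondop> whisker one (g \<diamondop> f) D \<diamondop> n
      = e \<diamondop> Braid X D \<diamondop> whisker one g D \<diamondop> whisker Y m one \<diamondop> n'"
    by (simp add: flat m1)
  also have "\<dots> = e \<diamondop> whisker one m X \<diamondop> Braid X D' \<diamondop> whisker one g D' \<diamondop> n'"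
    by (simp add: comp_cong22[OF g_m] comp_cong22[OF B_m])
  also have "\<dots> = e' \<diamondop> Braid Y D' \<diamondop> whisker one f D' \<diamondop> whisker one g D' \<diamondop> n'"
    by (simp add: comp_cong22[OF m2] comp_cong22[OF B_f])
  finally show ?thesis by (simp add: flat)
qed

text \<open>
  The right cap obtained from a left one by a crossing is not multiplicative: for two parallel
  strands it leaves them wound around each other.  The double braiding, which the balancing
  contributes on a tensor product, undoes this, and two nested caps remain.
\<close>

lemma right_evaluation_tens:
  assumes e [simp]: "wf e" "src e = D \<otimes> X" "tgt e = one"
    and e' [simp]: "wf e'" "src e' = D' \<otimes> Y" "tgt e' = one"
  shows "(e' \<diamondop> whisker D' e Y) \<diamondop> Braid (X \<otimes> Y) (D' \<otimes> D) \<diamondop> whisker one (Braid Y X \<diamondop> Braid X Y) (D' \<otimes> D)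
       = e \<diamondop> Braid X D \<diamondop> whisker X (e' \<diamondop> Braid Y D') D"
proof -
  let ?W = "D' \<otimes> D"
  define cap where "cap = e' \<diamondop> whisker D' e Y"
  have [simp]: "wf cap" "src cap = D' \<otimes> D \<otimes> X \<otimes> Y" "tgt cap = one" by (simp_all add: cap_def)
  have 1: "Braid (X \<otimes> Y) ?W \<diamondop> whisker one (Braid Y X) ?W
      = whisker ?W (Braid Y X) one \<diamondop> Braid (Y \<otimes> X) ?W"
    using Braid_natural_left[of "Braid Y X" ?W] by simp
  have 2: "whisker ?W (Braid Y X) one \<diamondop> whisker one (Braid Y ?W) X = Braid Y (D' \<otimes> D \<otimes> X)"
    using Braid_tens_right[of Y ?W X] by simp
  have 3: "cap \<diamondop> Braid Y (D' \<otimes> D \<otimes> X) = e' \<diamondop> Braid Y D' \<diamondop> whisker (Y \<otimes> D') e one"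
    using Braid_natural_right[of "whisker D' e one" Y] by (simp add: cap_def flat)
  have 4: "whisker (Y \<otimes> D') (Braid X D) one \<diamondop> whisker Y (Braid X D') D = whisker Y (Braid X ?W) one"
    by (simp add: Braid_tens_right[of X D' D] flat)
  have 5: "whisker Y (Braid X D') D \<diamondop> whisker one (Braid X Y) ?W = whisker one (Braid X (Y \<otimes> D')) D"
    by (simp add: Braid_tens_right[of X Y D'] flat)
  define f where "f = e' \<diamondop> Braid Y D'"
  have [simp]: "wf f" "src f = Y \<otimes> D'" "tgt f = one" by (simp_all add: f_def)
  have 6: "whisker one f (X \<otimes> D) \<diamondop> whisker one (Braid X (Y \<otimes> D')) D = whisker X f D"
    using arg_cong[OF Braid_natural_right[of f X], of "\<lambda>x. whisker one x D"] by (simp add: flat)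
  have 7: "f \<diamondop> whisker (Y \<otimes> D') (e \<diamondop> Braid X D) one = (e \<diamondop> Braid X D) \<diamondop> whisker one f (X \<otimes> D)"
    using interchange[of f "e \<diamondop> Braid X D" one one one] by simp
  have "cap \<diamondop> Braid (X \<otimes> Y) ?W \<diamondop> whisker one (Braid Y X \<diamondop> Braid X Y) ?W
      = cap \<diamondop> whisker ?W (Braid Y X) one \<diamondop> Braid (Y \<otimes> X) ?W \<diamondop> whisker one (Braid X Y) ?W"
    by (simp add: flat comp_cong22[OF 1])
  also have "\<dots>
      = cap \<diamondop> Braid Y (D' \<otimes> D \<otimes> X) \<diamondop> whisker Y (Braid X ?W) one \<diamondop> whisker one (Braid X Y) ?W"
    by (simp add: flat Braid_tens_left[of Y X ?W] comp_cong21[OF 2])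
  also have "\<dots>
      = f \<diamondop> whisker (Y \<otimes> D') e one \<diamondop> whisker Y (Braid X ?W) one \<diamondop> whisker one (Braid X Y) ?W"
  proof -
    have "cap \<diamondop> Braid Y (D' \<otimes> D \<otimes> X) \<diamondop> x = f \<diamondop> whisker (Y \<otimes> D') e one \<diamondop> x"
      if "wf x" "tgt x = Y \<otimes> D' \<otimes> D \<otimes> X" for x
      using arg_cong[OF 3, of "\<lambda>y. y \<diamondop> x"] that by (simp add: f_def comp_assoc)
    then show ?thesis by simp
  qed
  also have "\<dots> = f \<diamondop> whisker (Y \<otimes> D') (e \<diamondop> Braid X D) one \<diamondop> whisker one (Braid X (Y \<otimes> D')) D"
    by (simp add: flat 4[symmetric] 5[symmetric])
  also have "\<dots> = (e \<diamondop> Braid X D) \<diamondop> whisker one f (X \<otimes> D) \<diamondop> whisker one (Braid X (Y \<otimes> D')) D"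
    by (rule comp_cong22[OF 7]) simp_all
  also have "\<dots> = (e \<diamondop> Braid X D) \<diamondop> whisker X f D"
    by (simp add: 6)
  finally show ?thesis by (simp add: cap_def f_def comp_assoc)
qed

text \<open>
  The crossing makes \<open>X\<close> a dual of \<open>D\<close>.  The cap uses the crossing of \<open>X\<close> over \<open>D\<close>, hence the cup has to
  use the inverse of the crossing of \<open>D\<close> over \<open>X\<close>; otherwise the zigzags would contain curls.
\<close>

lemma dual_pair_braided:
  assumes X: "dual_pair X D e n"
  obtains n' where "dual_pair D X (e \<diamondop> Braid X D) n'" "Braid D X \<diamondop> n' = n"
proof -
  obtain c where c: "wf c" "src c = X \<otimes> D" "tgt c = D \<otimes> X"
      "c \<diamondop> Braid D X = Id (D \<otimes> X)" "Braid D X \<diamondop> c = Id (X \<otimes> D)"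
    by (rule Braid_inverse[where X = D and Y = X]) auto
  note [simp] = dual_pairD(1-6)[OF X] c(1-3)
  obtain k where k [simp]: "wf k" "src k = D \<otimes> D" "tgt k = D \<otimes> D"
    and k': "k \<diamondop> Braid D D = Id (D \<otimes> D)" "Braid D D \<diamondop> k = Id (D \<otimes> D)"
    by (rule Braid_inverse[of D D]) auto
  define e' where "e' = e \<diamondop> Braid X D"
  define n' where "n' = c \<diamondop> n"
  have [simp]: "wf e'" "src e' = X \<otimes> D" "tgt e' = one" "wf n'" "src n' = one" "tgt n' = D \<otimes> X"
    by (simp_all add: e'_def n'_def)
  have Braid_n': "Braid D X \<diamondop> n' = n"
    by (simp add: n'_def comp_cong21[OF c(5)])
  have whisker_n: "whisker L n R = whisker L (Braid D X) R \<diamondop> whisker L n' R" for L R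
    by (simp add: Braid_n'[symmetric] flat)
  have whisker_e': "whisker L e' R = whisker L e R \<diamondop> whisker L (Braid X D) R" for L R
    by (simp add: e'_def flat)

  \<comment> \<open>Both zigzags become those of the given duality once the strand is pulled across the cap and the cup.\<close>
  have 1: "whisker one e' X
      = whisker X e' one \<diamondop> whisker one (Braid X X) D \<diamondop> whisker X (Braid D X) one"
    using Braid_natural_left[of e' X] by (simp add: Braid_tens_left)
  have 2: "whisker one n X
      = whisker X (Braid X D) one \<diamondop> whisker one (Braid X X) D \<diamondop> whisker X n one"
    using Braid_natural_right[of n X] by (simp add: Braid_tens_right comp_assoc)
  have "whisker one e' X \<diamondop> whisker X n' one
      = whisker X e' one \<diamondop> whisker one (Braid X X) D \<diamondop> whisker X n one"
    by (simp add: 1 comp_assoc whisker_n)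
  also have "\<dots> = whisker X e one \<diamondop> whisker one n X"
    by (simp add: 2 whisker_e' comp_assoc)
  finally have zz2: "whisker one e' X \<diamondop> whisker X n' one = Id X"
    by (simp add: dual_pairD(7)[OF X])

  have kX: "whisker one k X \<diamondop> whisker one (Braid D D) X = Id (D \<otimes> D \<otimes> X)"
    and kX': "whisker one (Braid D D) X \<diamondop> whisker one k X = Id (D \<otimes> D \<otimes> X)"
    using arg_cong[OF k'(1), of "\<lambda>x. whisker one x X"] arg_cong[OF k'(2), of "\<lambda>x. whisker one x X"]
    by (simp_all add: flat)
  have 3: "whisker D (Braid X D) one \<diamondop> whisker one n' D = whisker one k X \<diamondop> whisker D n' one"
  proof -
    have "whisker D n' one
        = whisker one (Braid D D) X \<diamondop> whisker D (Braid X D) one \<diamondop> whisker one n' D"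
      using Braid_natural_left[of n' D] by (simp add: Braid_tens_left comp_assoc)
    then show ?thesis by (simp add: comp_cong21[OF kX])
  qed
  have 4: "whisker one e D \<diamondop> whisker D (Braid D X) one = whisker D e one \<diamondop> whisker one k X"
  proof -
    have "whisker D e one = whisker one e D \<diamondop> whisker D (Braid D X) one \<diamondop> whisker one (Braid D D) X"
      using Braid_natural_right[of e D] by (simp add: Braid_tens_right comp_assoc)
    then show ?thesis by (simp add: comp_assoc kX')
  qed
  have "whisker D e' one \<diamondop> whisker one n' D = whisker D e one \<diamondop> whisker one k X \<diamondop> whisker D n' one"
    by (simp add: whisker_e' comp_assoc 3)
  also have "\<dots> = whisker one e D \<diamondop> whisker D n one"
    by (simp add: whisker_n comp_cong22[OF 4])
  finally have zz1: "whisker D e' one \<diamondop> whisker one n' D = Id D"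
    by (simp add: dual_pairD(8)[OF X])
  have "dual_pair D X (e \<diamondop> Braid X D) n'" using zz1 zz2
    by (simp add: dual_pair_def flip: e'_def)
  then show ?thesis using Braid_n' by (rule that)
qed

end

section \<open>The canonical trace\<close>

context balanced_category
begin

definition Ev :: "'a \<Rightarrow> ('a, 'b) arrow" where
  "Ev X = Arrow (dual C X \<otimes> X) one (ev C X)"

definition Coev :: "'a \<Rightarrow> ('a, 'b) arrow" where
  "Coev X = Arrow one (X \<otimes> dual C X) (coev C X)"

definition Twist :: "'a \<Rightarrow> ('a, 'b) arrow" where
  "Twist X = Arrow X X (twist C X)"

lemma twist_in_hom: "twist C X \<in> hom C X X"
  using twist_iso by (simp add: is_iso_def)

lemma generator_simps [simp]:
  "src (Ev X) = dual C X \<otimes> X" "tgt (Ev X) = one" "wf (Ev X)"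
  "src (Coev X) = one" "tgt (Coev X) = X \<otimes> dual C X" "wf (Coev X)"
  "src (Twist X) = X" "tgt (Twist X) = X" "wf (Twist X)"
  by (simp_all add: Ev_def Coev_def Twist_def wf_def ev_in_hom coev_in_hom twist_in_hom)

lemma dual_pair_dual: "dual_pair X (dual C X) (Ev X) (Coev X)"
  using zigzag[of X] zigzag_dual[of X]
  by (simp add: dual_pair_def) (simp add: whisker_def comp_def Id_def Ev_def Coev_def
      tensm_unit_left[OF tensm_in_hom[OF coev_in_hom id_in_hom]] tensm_unit_right[OF ev_in_hom]
      tensm_unit_left[OF tensm_in_hom[OF ev_in_hom id_in_hom]] tensm_unit_right[OF coev_in_hom])

lemma Twist_natural: "wf f \<Longrightarrow> Twist (tgt f) \<diamondop> f = f \<diamondop> Twist (src f)"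
  by (auto simp: wf_def Twist_def comp_def intro: twist_natural)

lemma Twist_tens: "Twist (X \<otimes> Y)
    = (Braid Y X \<diamondop> Braid X Y) \<diamondop> whisker one (Twist X) Y \<diamondop> whisker X (Twist Y) one"
proof -
  note t = twist_in_hom
  have "twist C X \<star> twist C Y = (twist C X \<star> idm C Y) \<cdot> (idm C X \<star> twist C Y)"
    by (simp add: tensm_cmp[OF t id_in_hom id_in_hom t, symmetric] cmp_id_left[OF t] cmp_id_right[OF t])
  then have "Twist (X \<otimes> Y)
      = Braid Y X \<diamondop> Braid X Y \<diamondop> whisker one (Twist X) Y \<diamondop> whisker X (Twist Y) one"
    by (simp add: Twist_def Braid_def whisker_def comp_def twist_tens tensm_unit_right[OF t]
        tensm_unit_left[OF tensm_in_hom[OF t id_in_hom]])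
  then show ?thesis by (simp add: comp_assoc)
qed

lemma Twist_dual: "Twist (dual C X) =
    whisker one (Ev X) (dual C X) \<diamondop> whisker (dual C X) (Twist X) (dual C X)
    \<diamondop> whisker (dual C X) (Coev X) one"
  by (simp add: Twist_def whisker_def comp_def Ev_def Coev_def twist_dual transp_def
      tensm_unit_left[OF tensm_in_hom[OF ev_in_hom id_in_hom]] tensm_unit_right[OF coev_in_hom])

definition Tr :: "('a, 'b) arrow \<Rightarrow> complex" where
  "Tr f = tr C (src f) (mor f)"

lemma Tr_dual_pair:
  assumes f: "wf f" "tgt f = src f" and d: "dual_pair (src f) D e n"
  shows "Tr f = scalar_of C (mor (e \<diamondop> Braid (src f) D \<diamondop> whisker one (Twist (src f) \<diamondop> f) D \<diamondop> n))"
proof -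
  let ?X = "src f"
  have t: "(twist C ?X \<cdot> mor f) \<star> idm C (dual C ?X) \<in> hom C (?X \<otimes> dual C ?X) (?X \<otimes> dual C ?X)"
    using f by (intro tensm_in_hom id_in_hom cmp_in_hom[OF twist_in_hom]) (auto simp: wf_def)
  have "Tr f
      = scalar_of C (mor (Ev ?X \<diamondop> Braid ?X (dual C ?X) \<diamondop> whisker one ((Twist ?X \<diamondop> f)
      \<diamondop> Id ?X) (dual C ?X) \<diamondop> Coev ?X))"
    using f by (simp add: Tr_def tr_def)
      (simp add: Ev_def Coev_def Twist_def Braid_def comp_def whisker_def f tensm_unit_left[OF t])
  also have "\<dots> = scalar_of C (mor (e \<diamondop> Braid ?X D \<diamondop> whisker one (Id ?X \<diamondop> (Twist ?X \<diamondop> f)) D \<diamondop> n))"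
    using f by (subst dual_trace_cyclic[OF dual_pair_dual d]) simp_all
  finally show ?thesis using f by simp
qed

lemma Tr_cyclic:
  assumes [simp]: "wf f" "wf g" "tgt f = src g" "tgt g = src f"
  shows "Tr (g \<diamondop> f) = Tr (f \<diamondop> g)"
proof -
  have "Tr (g \<diamondop> f) = scalar_of C (mor (Ev (src f) \<diamondop> Braid (src f) (dual C (src f))
      \<diamondop> whisker one ((Twist (src f) \<diamondop> g) \<diamondop> f) (dual C (src f)) \<diamondop> Coev (src f)))"
    using dual_pair_dual[of "src f"]
    by (subst Tr_dual_pair[where D = "dual C (src f)"]) (simp_all add: comp_assoc)
  also have "\<dots> = scalar_of C (mor (Ev (src g) \<diamondop> Braid (src g) (dual C (src g))
      \<diamondop> whisker one (f \<diamondop> (Twist (src f) \<diamondop> g)) (dual C (src g)) \<diamondop> Coev (src g)))"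
    by (subst dual_trace_cyclic[OF dual_pair_dual dual_pair_dual]) simp_all
  also have "f \<diamondop> (Twist (src f) \<diamondop> g) = Twist (src g) \<diamondop> (f \<diamondop> g)"
    using Twist_natural[of "f \<diamondop> g"] Twist_natural[of g] by (simp add: comp_assoc)
  also have "scalar_of C (mor (Ev (src g) \<diamondop> Braid (src g) (dual C (src g))
      \<diamondop> whisker one \<dots> (dual C (src g)) \<diamondop> Coev (src g))) = Tr (f \<diamondop> g)"
    using dual_pair_dual[of "src g"]
    by (subst Tr_dual_pair[where D = "dual C (src g)"]) simp_all
  finally show ?thesis .
qed

text \<open>
  Take \<open>X\<close> as the dual of its dual.  The crossing in the cup cancels one of the two crossings of the
  closure, and the twist of the dual, which is the mate of the twist of \<open>X\<close>, slides back to \<open>X\<close>.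
\<close>

lemma Tr_dual_id: "Tr (Id (dual C X)) = Tr (Id X)"
proof -
  let ?D = "dual C X"
  obtain n where d: "dual_pair ?D X (Ev X \<diamondop> Braid X ?D) n" and n: "Braid ?D X \<diamondop> n = Coev X"
    by (rule dual_pair_braided[OF dual_pair_dual])
  note [simp] = dual_pairD(4-6)[OF d]
  obtain m where m: "m = Twist ?D" and E_m: "Ev X \<diamondop> whisker one m X
      = Ev X \<diamondop> whisker ?D (Twist X) one"
    using mate_exists[OF dual_pair_dual dual_pair_dual, of "Twist X"] Twist_dual[of X] by auto
  have 1: "Braid ?D X \<diamondop> whisker one (Twist ?D) X = whisker X (Twist ?D) one \<diamondop> Braid ?D X"
    using Braid_natural_left[of "Twist ?D" X] by simp
  have 2: "Braid X ?D \<diamondop> whisker X (Twist ?D) one = whisker one (Twist ?D) X \<diamondop> Braid X ?D"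
    using Braid_natural_right[of "Twist ?D" X] by simp
  have 3: "whisker ?D (Twist X) one \<diamondop> Braid X ?D = Braid X ?D \<diamondop> whisker one (Twist X) ?D"
    using Braid_natural_left[of "Twist X" ?D] by simp
  have "(Ev X \<diamondop> Braid X ?D) \<diamondop> Braid ?D X \<diamondop> whisker one (Twist ?D) X \<diamondop> n
      = Ev X \<diamondop> Braid X ?D \<diamondop> whisker X (Twist ?D) one \<diamondop> Coev X"
    by (simp add: comp_assoc comp_cong22[OF 1] n)
  also have "\<dots> = Ev X \<diamondop> Braid X ?D \<diamondop> whisker one (Twist X) ?D \<diamondop> Coev X"
    by (simp add: comp_cong22[OF 2] comp_cong22[OF E_m[unfolded m]] comp_cong22[OF 3])
  finally show ?thesis
    using Tr_dual_pair[of "Id ?D"] d Tr_dual_pair[of "Id X"] dual_pair_dual[of X] by simp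
qed

text \<open>
  The cap is the one of the closure to an annulus, so this is the trace of \<open>f\<close> if \<open>X\<close> is the unit.
\<close>

definition partial_trace :: "'a \<Rightarrow> 'a \<Rightarrow> ('a, 'b) arrow \<Rightarrow> ('a, 'b) arrow" where
  "partial_trace X Y f = whisker X (Ev Y \<diamondop> Braid Y (dual C Y) \<diamondop> whisker one (Twist Y) (dual C Y)) one
     \<diamondop> whisker one f (dual C Y) \<diamondop> whisker X (Coev Y) one"

lemma partial_trace_simps [simp]:
  assumes "wf f" "src f = X \<otimes> Y" "tgt f = X \<otimes> Y"
  shows "wf (partial_trace X Y f)" "src (partial_trace X Y f) = X" "tgt (partial_trace X Y f) = X"
  using assms by (simp_all add: partial_trace_def)

text \<open>
  Use the dual of \<open>X \<otimes> Y\<close> made of the duals of the factors.  The full twist in \<open>Twist_tens\<close> turns its right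
  evaluation into two nested caps by \<open>right_evaluation_tens\<close>.
\<close>

lemma Tr_partial_trace:
  assumes [simp]: "wf f" "src f = X \<otimes> Y" "tgt f = X \<otimes> Y"
  shows "Tr f = Tr (partial_trace X Y f)"
proof -
  let ?D = "dual C X" and ?D' = "dual C Y"
  let ?W = "?D' \<otimes> ?D"
  define r where "r = Ev Y \<diamondop> Braid Y ?D'"
  have [simp]: "wf r" "src r = Y \<otimes> ?D'" "tgt r = one" by (simp_all add: r_def)
  have slide: "whisker X r ?D \<diamondop> whisker one (Twist X) (Y \<otimes> ?D' \<otimes> ?D)
      = whisker one (Twist X) ?D \<diamondop> whisker X r ?D"
    using interchange[of "Twist X" r one one ?D] by simp
  have "(Ev Y \<diamondop> whisker ?D' (Ev X) Y) \<diamondop> Braid (X \<otimes> Y) ?W \<diamondop> whisker one (Twist (X \<otimes> Y) \<diamondop> f) ?W \<diamondop> whisker X (Coev Y) ?D \<diamondop> Coev X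
      = ((Ev Y \<diamondop> whisker ?D' (Ev X) Y) \<diamondop> Braid (X \<otimes> Y) ?W \<diamondop> whisker one (Braid Y X
      \<diamondop> Braid X Y) ?W) \<diamondop>
        whisker one (Twist X) (Y \<otimes> ?W) \<diamondop> whisker X (Twist Y) ?W \<diamondop> whisker one f ?W
        \<diamondop> whisker X (Coev Y) ?D \<diamondop> Coev X"
    by (simp add: Twist_tens flat)
  also have "\<dots> = (Ev X \<diamondop> Braid X ?D \<diamondop> whisker X r ?D) \<diamondop>
        whisker one (Twist X) (Y \<otimes> ?W) \<diamondop> whisker X (Twist Y) ?W \<diamondop> whisker one f ?W
        \<diamondop> whisker X (Coev Y) ?D \<diamondop> Coev X"
    by (subst right_evaluation_tens) (simp_all add: r_def)
  also have "\<dots> = Ev X \<diamondop> Braid X ?D \<diamondop> whisker one (Twist X) ?D \<diamondop> whisker X r ?D \<diamondop> whisker X (Twist Y) ?W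
        \<diamondop> whisker one f ?W \<diamondop> whisker X (Coev Y) ?D \<diamondop> Coev X"
    by (simp add: comp_assoc comp_cong22[OF slide])
  also have "\<dots> = Ev X \<diamondop> Braid X ?D \<diamondop> whisker one (Twist X \<diamondop> partial_trace X Y f) ?D \<diamondop> Coev X"
    by (simp add: partial_trace_def r_def flat)
  finally show ?thesis
    using Tr_dual_pair[of f] dual_pair_tens[OF dual_pair_dual[of X] dual_pair_dual[of Y]]
      Tr_dual_pair[of "partial_trace X Y f"] dual_pair_dual[of X] by simp
qed

lemma partial_trace_comp:
  assumes [simp]: "wf f" "src f = X \<otimes> Y" "tgt f = X \<otimes> Y" "wf g" "src g = X" "tgt g = X'"
    "wf h" "src h = X'" "tgt h = X"
  shows "partial_trace X' Y (whisker one g Y \<diamondop> f \<diamondop> whisker one h Y) = g \<diamondop> partial_trace X Y f \<diamondop> h"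
proof -
  define r where "r = Ev Y \<diamondop> Braid Y (dual C Y) \<diamondop> whisker one (Twist Y) (dual C Y)"
  have [simp]: "wf r" "src r = Y \<otimes> dual C Y" "tgt r = one" by (simp_all add: r_def)
  have 1: "whisker X' r one \<diamondop> whisker one g (Y \<otimes> dual C Y) = g \<diamondop> whisker X r one"
    using interchange[of g r one one one] by simp
  have 2: "whisker one h (Y \<otimes> dual C Y) \<diamondop> whisker X' (Coev Y) one = whisker X (Coev Y) one \<diamondop> h"
    using interchange[of h "Coev Y" one one one] by simp
  show ?thesis
    by (simp add: partial_trace_def flip: r_def) (simp add: flat 2 comp_cong22[OF 1])
qed

lemma partial_trace_whisker:
  assumes [simp]: "wf f" "src f = X \<otimes> Y" "tgt f = X \<otimes> Y"
  shows "partial_trace (L \<otimes> X) Y (whisker L f one) = whisker L (partial_trace X Y f) one"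
  by (simp add: partial_trace_def flat)

end

section \<open>Morphism spaces and simple objects\<close>

context linear_category
begin

text \<open>
  A basis indexed by a finite set, the form in which a decomposition into simple objects provides
  bases of morphism spaces.
\<close>

definition basis_family :: "'i set \<Rightarrow> ('i \<Rightarrow> 'm) \<Rightarrow> 'm set \<Rightarrow> bool" where
  "basis_family A b V \<longleftrightarrow> finite A \<and> (\<forall>c. (\<Sum>a\<in>A. smult C (c a) (b a)) \<in> V)
     \<and> (\<forall>v\<in>V. \<exists>c. v = (\<Sum>a\<in>A. smult C (c a) (b a)))
     \<and> (\<forall>c. (\<Sum>a\<in>A. smult C (c a) (b a)) = 0 \<longrightarrow> (\<forall>a\<in>A. c a = 0))"

lemma dim_basis_family:
  assumes "basis_family A b V"
  shows "dim V = card A"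
proof -
  have A: "finite A" and mem: "\<And>c. (\<Sum>a\<in>A. smult C (c a) (b a)) \<in> V"
    and spans: "\<And>v. v \<in> V \<Longrightarrow> \<exists>c. v = (\<Sum>a\<in>A. smult C (c a) (b a))"
    and indep: "\<And>c a. (\<Sum>a\<in>A. smult C (c a) (b a)) = 0 \<Longrightarrow> a \<in> A \<Longrightarrow> c a = 0"
    using assms by (auto simp: basis_family_def)
  have inj: "inj_on b A"
  proof (rule inj_onI, rule ccontr)
    fix x y assume xy: "x \<in> A" "y \<in> A" "b x = b y" "x \<noteq> y"
    let ?c = "\<lambda>a. if a = x then 1 else if a = y then - 1 else 0"
    have "(\<Sum>a\<in>A. smult C (?c a) (b a)) = (\<Sum>a\<in>{x, y}. smult C (?c a) (b a))"
      using A xy by (intro sum.mono_neutral_right) auto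
    also have "\<dots> = 0" using xy by simp
    finally show False using indep[of ?c x] xy by simp
  qed
  have "independent (b ` A)"
  proof (rule independent_if_scalars_zero)
    fix c x assume "(\<Sum>y\<in>b ` A. smult C (c y) y) = 0" "x \<in> b ` A"
    then show "c x = 0" using indep[of "\<lambda>a. c (b a)"] by (auto simp: sum.reindex[OF inj])
  qed (use A in simp)
  moreover have "span (b ` A) = V"
  proof
    show "V \<subseteq> span (b ` A)"
      using spans by (blast intro: span_sum span_scale span_base)
    show "span (b ` A) \<subseteq> V"
    proof
      fix v assume "v \<in> span (b ` A)"
      then obtain c where "v = (\<Sum>y\<in>b ` A. smult C (c y) y)"
        using A by (auto simp: span_finite)
      then show "v \<in> V" using mem[of "\<lambda>a. c (b a)"] by (simp add: sum.reindex[OF inj])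
    qed
  qed
  ultimately have "dim V = card (b ` A)"
    using dim_eq_card[of "b ` A" V] by (metis span_span)
  then show ?thesis by (simp add: card_image[OF inj])
qed

text \<open>
  Bending of strands is linear only on a morphism space, not on the ambient vector space, so the
  invariance of dimension under linear isomorphisms is needed in this relative form.
\<close>

lemma basis_family_image:
  assumes V: "basis_family A b V" and sub: "subspace V"
    and add: "\<And>v v'. v \<in> V \<Longrightarrow> v' \<in> V \<Longrightarrow> f (v + v') = f v + f v'"
    and smult: "\<And>a v. v \<in> V \<Longrightarrow> f (smult C a v) = smult C a (f v)"
    and bij: "bij_betw f V W"
  shows "basis_family A (\<lambda>a. f (b a)) W"
proof -
  have A: "finite A" and mem: "\<And>c. (\<Sum>a\<in>A. smult C (c a) (b a)) \<in> V"
    and spans: "\<And>v. v \<in> V \<Longrightarrow> \<exists>c. v = (\<Sum>a\<in>A. smult C (c a) (b a))"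
    and indep: "\<And>c a. (\<Sum>a\<in>A. smult C (c a) (b a)) = 0 \<Longrightarrow> a \<in> A \<Longrightarrow> c a = 0"
    using V by (auto simp: basis_family_def)
  have b: "b a \<in> V" if "a \<in> A" for a
  proof -
    have "(\<Sum>x\<in>A. smult C (if x = a then 1 else 0) (b x)) = (\<Sum>x\<in>{a}. b x)"
      using that A by (intro sum.mono_neutral_cong_right) auto
    then show ?thesis using mem[of "\<lambda>x. if x = a then 1 else 0"] by simp
  qed
  have f0: "f 0 = 0"
    using smult[of 0 0] subspace_0[OF sub] by simp
  have f_sum: "f (\<Sum>a\<in>A. smult C (c a) (b a)) = (\<Sum>a\<in>A. smult C (c a) (f (b a)))" for c
  proof -
    have "(\<Sum>a\<in>F. smult C (c a) (b a)) \<in> V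
        \<and> f (\<Sum>a\<in>F. smult C (c a) (b a)) = (\<Sum>a\<in>F. smult C (c a) (f (b a)))"
      if "finite F" "F \<subseteq> A" for F
      using that
      by (induction F rule: finite_induct)
        (auto simp: f0 add smult b subspace_0[OF sub] subspace_add[OF sub] subspace_scale[OF sub])
    then show ?thesis using A by blast
  qed
  show ?thesis
    unfolding basis_family_def
  proof (intro conjI allI ballI impI)
    show "finite A" by (fact A)
    show "(\<Sum>a\<in>A. smult C (c a) (f (b a))) \<in> W" for c
      using mem[of c] bij_betwE[OF bij] by (auto simp flip: f_sum)
    show "\<exists>c. v = (\<Sum>a\<in>A. smult C (c a) (f (b a)))" if "v \<in> W" for v
    proof -
      obtain v' where "v' \<in> V" "v = f v'" using bij \<open>v \<in> W\<close> by (auto simp: bij_betw_def)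
      then show ?thesis using spans[of v'] f_sum by metis
    qed
    show "c a = 0" if "(\<Sum>a\<in>A. smult C (c a) (f (b a))) = 0" "a \<in> A" for c a
    proof (rule indep)
      have "f (\<Sum>a\<in>A. smult C (c a) (b a)) = f 0" using that by (simp add: f_sum f0)
      then show "(\<Sum>a\<in>A. smult C (c a) (b a)) = 0"
        using bij mem[of c] subspace_0[OF sub] by (auto simp: bij_betw_def dest: inj_onD)
    qed (fact that)
  qed
qed

lemma hom_0: "0 \<in> hom C X Y"
  and hom_add: "\<lbrakk>f \<in> hom C X Y; g \<in> hom C X Y\<rbrakk> \<Longrightarrow> f + g \<in> hom C X Y"
  and hom_diff: "\<lbrakk>f \<in> hom C X Y; g \<in> hom C X Y\<rbrakk> \<Longrightarrow> f - g \<in> hom C X Y"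
  and hom_smult: "f \<in> hom C X Y \<Longrightarrow> a \<odot> f \<in> hom C X Y"
  and hom_sum: "(\<And>k. k \<in> A \<Longrightarrow> F k \<in> hom C X Y) \<Longrightarrow> sum F A \<in> hom C X Y"
  using hom_subspace[of X Y] subspace_0 subspace_add subspace_diff subspace_scale subspace_sum by blast+

lemma cmp_0_left: "f \<in> hom C X Y \<Longrightarrow> 0 \<cdot> f = 0"
  using cmp_smult_left[OF hom_0, of f X Y 0] by simp

lemma cmp_0_right: "g \<in> hom C Y Z \<Longrightarrow> g \<cdot> 0 = 0"
  using cmp_smult_right[OF _ hom_0, of g Y Z 0] by simp

lemma cmp_sum_left:
  assumes "f \<in> hom C X Y" "finite A" "\<And>k. k \<in> A \<Longrightarrow> G k \<in> hom C Y Z"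
  shows "sum G A \<cdot> f = (\<Sum>k\<in>A. G k \<cdot> f)"
  using assms(2,3)
  by (induction A rule: finite_induct)
    (auto simp: cmp_0_left[OF assms(1)] cmp_add_left[OF _ _ assms(1), of _ Z] hom_sum)

lemma cmp_sum_right:
  assumes "g \<in> hom C Y Z" "finite A" "\<And>k. k \<in> A \<Longrightarrow> F k \<in> hom C X Y"
  shows "g \<cdot> sum F A = (\<Sum>k\<in>A. g \<cdot> F k)"
  using assms(2,3)
  by (induction A rule: finite_induct)
    (auto simp: cmp_0_right[OF assms(1)] cmp_add_right[OF assms(1), of _ X] hom_sum)

end

context abelian_category
begin

text \<open>
  Schur's lemma.  The kernel of \<open>f\<close> is zero or all of \<open>X\<close>.  In the first case \<open>f\<close> is monic, and the
  simplicity of \<open>Y\<close> applies.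
\<close>

lemma simple_hom_zero_or_iso:
  assumes X: "is_simple C X" and Y: "is_simple C Y" and f: "f \<in> hom C X Y" "f \<noteq> 0"
  shows "is_iso C X Y f"
proof -
  obtain K k where k: "is_kernel C K X Y k f" using kernels[OF f(1)] by blast
  then have k_in: "k \<in> hom C K X" and fk: "f \<cdot> k = 0"
    and univ: "\<And>W h. h \<in> hom C W X \<Longrightarrow> f \<cdot> h = 0 \<Longrightarrow> \<exists>!x. x \<in> hom C W K \<and> k \<cdot> x = h"
    by (auto simp: is_kernel_def)
  have "monic C K X k"
    unfolding monic_def
  proof (intro conjI allI ballI impI k_in)
    fix W g h assume g: "g \<in> hom C W K" and h: "h \<in> hom C W K" and eq: "k \<cdot> g = k \<cdot> h"
    have "f \<cdot> k \<cdot> h = 0"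
      using cmp_assoc[OF f(1) k_in h] fk cmp_0_left[OF h] by simp
    then show "g = h" using univ[OF cmp_in_hom[OF k_in h]] g h eq by blast
  qed
  then have "k = 0 \<or> is_iso C K X k" using X by (auto simp: is_simple_def)
  moreover have "\<not> is_iso C K X k"
  proof
    assume "is_iso C K X k"
    then obtain g where g: "g \<in> hom C X K" "k \<cdot> g = idm C X" by (auto simp: is_iso_def)
    have "f = (f \<cdot> k) \<cdot> g"
      using cmp_assoc[OF f(1) k_in g(1)] g cmp_id_right[OF f(1)] by simp
    then show False using fk cmp_0_left[OF g(1)] f(2) by simp
  qed
  ultimately have k0: "k = 0" by blast
  have "monic C X Y f"
    unfolding monic_def
  proof (intro conjI allI ballI impI f(1))
    fix W g h assume g: "g \<in> hom C W X" and h: "h \<in> hom C W X" and eq: "f \<cdot> g = f \<cdot> h"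
    have "f \<cdot> g = f \<cdot> (g - h) + f \<cdot> h"
      using cmp_add_right[OF f(1) hom_diff[OF g h] h] by simp
    then obtain x where "x \<in> hom C W K" "k \<cdot> x = g - h"
      using univ[OF hom_diff[OF g h]] eq by auto
    then show "g = h" using cmp_0_left[of x] k0 by simp
  qed
  then show ?thesis using Y f(2) by (auto simp: is_simple_def)
qed

end

section \<open>The entries of the S-matrix as characters of the fusion ring\<close>

context semisimple_category
begin

lemma scalar_eq_iff: "a \<odot> idm C (rep i) = b \<odot> idm C (rep i) \<longleftrightarrow> a = b"
  using rep_simple[of i] by (auto simp: is_simple_def)

lemma tr_linear:
  assumes f: "f \<in> hom C X X"
  shows tr_add: "g \<in> hom C X X \<Longrightarrow> tr C X (f + g) = tr C X f + tr C X g"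
    and tr_smult: "tr C X (a \<odot> f) = a * tr C X f"
proof -
  let ?cl = "\<lambda>f. ev C X \<cdot> braid C X (dual C X) \<cdot> ((twist C X \<cdot> f) \<star> idm C (dual C X)) \<cdot> coev C X"
  note i = id_in_hom and t = twist_in_hom
  note [intro] = tensm_in_hom[OF _ i] cmp_in_hom[OF t]
  have cl: "?cl h = tr C X h \<odot> idm C (rep u)" if "h \<in> hom C X X" for h
    using tr_wellformed[OF that] by (simp add: rep_unit)
  have mid: "((twist C X \<cdot> h) \<star> idm C (dual C X)) \<cdot> coev C X \<in> hom C one (X \<otimes> dual C X)"
    and pre: "(twist C X \<cdot> h) \<star> idm C (dual C X) \<in> hom C (X \<otimes> dual C X) (X \<otimes> dual C X)"
    if "h \<in> hom C X X" for h
    using that by (auto intro: cmp_in_hom[OF _ coev_in_hom])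
  note br = cmp_in_hom[OF braid_in_hom mid]
  {
    assume g: "g \<in> hom C X X"
    have "?cl (f + g) = ?cl f + ?cl g"
      using f g by (simp add: cmp_add_right[OF t f g] tensm_add_left[OF cmp_in_hom[OF t f] cmp_in_hom[OF t g] i]
          cmp_add_left[OF pre pre coev_in_hom] cmp_add_right[OF braid_in_hom mid mid]
          cmp_add_right[OF ev_in_hom br br])
    then have "tr C X (f + g) \<odot> idm C (rep u) = (tr C X f + tr C X g) \<odot> idm C (rep u)"
      using f g by (simp add: cl hom_add scale_left_distrib)
    then show "tr C X (f + g) = tr C X f + tr C X g" by (simp only: scalar_eq_iff)
  }
  have "?cl (a \<odot> f) = a \<odot> ?cl f"
    using f by (simp add: cmp_smult_right[OF t f] tensm_smult_left[OF cmp_in_hom[OF t f] i]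
        cmp_smult_left[OF pre coev_in_hom] cmp_smult_right[OF braid_in_hom mid]
        cmp_smult_right[OF ev_in_hom br])
  then have "tr C X (a \<odot> f) \<odot> idm C (rep u) = (a * tr C X f) \<odot> idm C (rep u)"
    using f by (simp add: cl hom_smult)
  then show "tr C X (a \<odot> f) = a * tr C X f" by (simp only: scalar_eq_iff)
qed

lemma tr_sum:
  assumes "finite A" "\<And>k. k \<in> A \<Longrightarrow> F k \<in> hom C X X"
  shows "tr C X (sum F A) = (\<Sum>k\<in>A. tr C X (F k))"
  using assms
proof (induction A rule: finite_induct)
  case empty
  show ?case using tr_smult[OF hom_0[of X X], of 0] by simp
next
  case (insert k A)
  then show ?case by (simp add: tr_add hom_sum)
qed

lemma Tr_scal: "\<lbrakk>wf f; tgt f = src f\<rbrakk> \<Longrightarrow> Tr (scal a f) = a * Tr f"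
  by (auto simp: Tr_def wf_def tr_smult)

lemma endo_rep:
  assumes "wf f" "src f = rep i" "tgt f = rep i"
  obtains a where "f = scal a (Id (rep i))"
proof -
  have "mor f \<in> hom C (rep i) (rep i)" using assms by (simp add: wf_def)
  then obtain a where "mor f = a \<odot> idm C (rep i)" by (auto simp: rep_End)
  then have "f = scal a (Id (rep i))" by (intro arrow.expand) (simp add: assms Id_def)
  then show ?thesis by (rule that)
qed

lemma S_val_Tr: "S_val C X Y = Tr (Braid Y X \<diamondop> Braid X Y)"
  by (simp add: S_val_def Tr_def) (simp add: comp_def Braid_def)

lemma S_val_sym: "S_val C X Y = S_val C Y X"
  unfolding S_val_Tr by (rule Tr_cyclic) simp_all

lemma qdim_Tr: "qdim C X = Tr (Id X)"
  by (simp add: qdim_def Tr_def Id_def)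

lemma qdim_dual: "qdim C (dual C X) = qdim C X"
  by (simp add: qdim_Tr Tr_dual_id)

lemma Twist_unit: "Twist one = Id one"
proof -
  have "is_iso C one one (twist C one)" by (rule twist_iso)
  moreover have "twist C one = twist C one \<cdot> twist C one"
  proof -
    have "Twist one = Twist one \<diamondop> Twist one" using Twist_tens[of one one] by simp
    then show ?thesis by (simp add: Twist_def comp_def)
  qed
  ultimately show ?thesis using iso_idempotent by (simp add: Twist_def Id_def)
qed

lemma qdim_unit: "qdim C one = 1"
proof -
  have "dual_pair one one (Id one) (Id one)" by (simp add: dual_pair_def)
  then have "qdim C one = scalar_of C (idm C one)"
    using Tr_dual_pair[of "Id one" one "Id one" "Id one"] by (simp add: qdim_Tr Twist_unit) (simp add: Id_def)
  moreover have "scalar_of C (idm C one) = 1"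
    unfolding scalar_of_def using scalar_eq_iff[of 1 u]
    by (intro the_equality) (auto simp: rep_unit)
  ultimately show ?thesis by simp
qed

text \<open>
  Closing the strand \<open>Z\<close> around the simple \<open>i\<close> gives a scalar \<open>a\<close>, and \<open>S(i, Z) = a dim(i)\<close>.  In the diagram
  of \<open>S(i, Y \<otimes> Z)\<close> the strand \<open>Z\<close> encircles \<open>i\<close> between the two crossings of \<open>i\<close> with \<open>Y\<close>, so its
  partial trace contributes the factor \<open>a\<close> and leaves the diagram of \<open>S(i, Y)\<close>.
\<close>

lemma S_val_tens:
  "S_val C (rep i) (Y \<otimes> Z) * qdim C (rep i) = S_val C (rep i) Y * S_val C (rep i) Z"
proof -
  let ?X = "rep i"
  let ?f = "Braid Z ?X \<diamondop> Braid ?X Z"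
  obtain a where a: "partial_trace ?X Z ?f = scal a (Id ?X)"
    by (rule endo_rep[of "partial_trace ?X Z ?f" i]) auto
  have S_Z: "S_val C ?X Z = a * qdim C ?X"
    by (simp add: S_val_Tr Tr_partial_trace[of ?f ?X Z] a Tr_scal qdim_Tr)
  have "Braid (Y \<otimes> Z) ?X \<diamondop> Braid ?X (Y \<otimes> Z)
      = whisker one (Braid Y ?X) Z \<diamondop> whisker Y ?f one \<diamondop> whisker one (Braid ?X Y) Z"
    by (simp add: Braid_tens_left Braid_tens_right flat)
  then have "S_val C ?X (Y \<otimes> Z)
      = Tr (partial_trace (?X \<otimes> Y) Z (whisker one (Braid Y ?X) Z \<diamondop> whisker Y ?f one
      \<diamondop> whisker one (Braid ?X Y) Z))"
    unfolding S_val_Tr by (subst Tr_partial_trace[of _ "?X \<otimes> Y" Z]) simp_all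
  also have "\<dots> = Tr (Braid Y ?X \<diamondop> whisker Y (scal a (Id ?X)) one \<diamondop> Braid ?X Y)"
    by (subst partial_trace_comp[where X = "Y \<otimes> ?X"]) (simp_all add: partial_trace_whisker a)
  also have "\<dots> = a * S_val C ?X Y"
    by (simp add: whisker_scal comp_scal_left comp_scal_right Tr_scal S_val_Tr)
  finally show ?thesis by (simp add: S_Z)
qed

text \<open>
  Insert the decomposition of the identity of \<open>Y\<close>; by cyclicity each projection and inclusion
  meet again after passing both crossings.
\<close>

lemma S_val_direct_sum:
  assumes d: "is_direct_sum C n F Y q p"
  shows "S_val C X Y = (\<Sum>k<n. S_val C X (F k))"
proof -
  have q: "k < n \<Longrightarrow> q k \<in> hom C (F k) Y" and p: "k < n \<Longrightarrow> p k \<in> hom C Y (F k)"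
    and pq: "k < n \<Longrightarrow> p k \<cdot> q k = idm C (F k)" for k
    using d by (auto simp: is_direct_sum_def)
  have id: "(\<Sum>k<n. q k \<cdot> p k) = idm C Y" using d by (simp add: is_direct_sum_def)
  let ?b = "\<lambda>Y. Braid Y X \<diamondop> Braid X Y"
  have Y: "q k \<cdot> p k \<in> hom C Y Y" if "k < n" for k
    by (rule cmp_in_hom[OF q[OF that] p[OF that]])
  let ?e = "\<lambda>k. Arrow Y Y (q k \<cdot> p k)"
  have b_in: "mor (?b Y) \<in> hom C (X \<otimes> Y) (X \<otimes> Y)"
    using wf_comp[of "Braid Y X" "Braid X Y"] unfolding wf_def[of "_ \<diamondop> _"] by simp
  have e_in: "mor (whisker X (?e k) one \<diamondop> ?b Y) \<in> hom C (X \<otimes> Y) (X \<otimes> Y)" if "k < n" for k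
  proof -
    have "wf (?e k)" using Y[OF that] by (simp add: wf_def)
    then have "wf (whisker X (?e k) one \<diamondop> ?b Y)" by simp
    then show ?thesis unfolding wf_def[of "_ \<diamondop> _"] by simp
  qed
  have "mor (?b Y) = (idm C X \<star> (\<Sum>k<n. q k \<cdot> p k)) \<cdot> mor (?b Y)"
    by (simp add: id tensm_id cmp_id_left[OF b_in])
  also have "idm C X \<star> (\<Sum>k<n. q k \<cdot> p k) = (\<Sum>k<n. idm C X \<star> (q k \<cdot> p k))"
  proof -
    have "idm C X \<star> (\<Sum>k\<in>A. q k \<cdot> p k) = (\<Sum>k\<in>A. idm C X \<star> (q k \<cdot> p k))"
      if "finite A" "A \<subseteq> {..<n}" for A
      using that
    proof (induction A rule: finite_induct)
      case empty
      show ?case using tensm_smult_right[OF id_in_hom[of X] hom_0[of Y Y], of 0] by simp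
    next
      case (insert k A)
      then have "(\<Sum>k\<in>A. q k \<cdot> p k) \<in> hom C Y Y" "q k \<cdot> p k \<in> hom C Y Y"
        by (auto intro!: hom_sum Y)
      then show ?case using insert by (simp add: tensm_add_right[OF id_in_hom])
    qed
    then show ?thesis by auto
  qed
  also have "\<dots> \<cdot> mor (?b Y) = (\<Sum>k<n. (idm C X \<star> (q k \<cdot> p k)) \<cdot> mor (?b Y))"
    by (rule cmp_sum_left[OF b_in]) (auto intro: tensm_in_hom id_in_hom Y)
  also have "\<dots> = (\<Sum>k<n. mor (whisker X (?e k) one \<diamondop> ?b Y))"
    by (intro sum.cong) (auto simp: comp_def whisker_def tensm_unit_right[OF Y])
  finally have "S_val C X Y = (\<Sum>k<n. tr C (X \<otimes> Y) (mor (whisker X (?e k) one \<diamondop> ?b Y)))"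
    by (simp add: S_val_Tr Tr_def) (intro tr_sum, auto intro: e_in)
  also have "\<dots> = (\<Sum>k<n. Tr (whisker X (?e k) one \<diamondop> ?b Y))" by (simp add: Tr_def)
  also have "\<dots> = (\<Sum>k<n. S_val C X (F k))"
  proof (rule sum.cong[OF refl])
    fix k assume "k \<in> {..<n}"
    then have k: "k < n" by simp
    define P where "P = Arrow Y (F k) (p k)"
    define Q where "Q = Arrow (F k) Y (q k)"
    have [simp]: "wf P" "src P = Y" "tgt P = F k" "wf Q" "src Q = F k" "tgt Q = Y"
      using p[OF k] q[OF k] by (simp_all add: P_def Q_def wf_def)
    have e: "?e k = Q \<diamondop> P" and PQ: "P \<diamondop> Q = Id (F k)"
      using pq[OF k] by (simp_all add: P_def Q_def comp_def Id_def)
    have 1: "whisker X P one \<diamondop> Braid Y X = Braid (F k) X \<diamondop> whisker one P X"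
      using Braid_natural_left[of P X] by simp
    have 2: "whisker one P X \<diamondop> Braid X Y = Braid X (F k) \<diamondop> whisker X P one"
      using Braid_natural_right[of P X] by simp
    have 3: "whisker X P one \<diamondop> whisker X Q one = Id (X \<otimes> F k)"
      using PQ by (simp flip: whisker_comp)
    have "Tr (whisker X (?e k) one \<diamondop> ?b Y) = Tr (whisker X Q one \<diamondop> (whisker X P one \<diamondop> ?b Y))"
      by (simp add: e flat)
    also have "\<dots> = Tr ((whisker X P one \<diamondop> ?b Y) \<diamondop> whisker X Q one)"
      by (rule Tr_cyclic) simp_all
    also have "(whisker X P one \<diamondop> ?b Y) \<diamondop> whisker X Q one = ?b (F k)"
      by (simp add: comp_assoc comp_cong22[OF 1] comp_cong22[OF 2] 3)
    finally show "Tr (whisker X (?e k) one \<diamondop> ?b Y) = S_val C X (F k)" by (simp add: S_val_Tr)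
  qed
  finally show ?thesis .
qed

end

section \<open>Fusion multiplicities\<close>

context semisimple_category
begin

lemma decomposition:
  obtains n r q p where "is_direct_sum C n (\<lambda>k. rep (r k)) X q p"
proof -
  obtain n F q p where F: "\<And>k. k < n \<Longrightarrow> is_simple C (F k)" and d: "is_direct_sum C n F X q p"
    using semisimple[of X] by auto
  have "\<exists>i g h. g \<in> hom C (F k) (rep i) \<and> h \<in> hom C (rep i) (F k)
      \<and> h \<cdot> g = idm C (F k) \<and> g \<cdot> h = idm C (rep i)" if "k < n" for k
    using rep_unique[OF F[OF that]] by (auto simp: isomorphic_def is_iso_def)
  then obtain r g h where g: "\<And>k. k < n \<Longrightarrow> g k \<in> hom C (F k) (rep (r k))"
    and h: "\<And>k. k < n \<Longrightarrow> h k \<in> hom C (rep (r k)) (F k)"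
    and hg: "\<And>k. k < n \<Longrightarrow> h k \<cdot> g k = idm C (F k)"
    and gh: "\<And>k. k < n \<Longrightarrow> g k \<cdot> h k = idm C (rep (r k))"
    by metis
  have q: "k < n \<Longrightarrow> q k \<in> hom C (F k) X" and p: "k < n \<Longrightarrow> p k \<in> hom C X (F k)"
    and pq: "k < n \<Longrightarrow> l < n \<Longrightarrow> p k \<cdot> q l = (if k = l then idm C (F k) else 0)" for k l
    using d by (auto simp: is_direct_sum_def)
  have id: "(\<Sum>k<n. q k \<cdot> p k) = idm C X" using d by (simp add: is_direct_sum_def)
  have "is_direct_sum C n (\<lambda>k. rep (r k)) X (\<lambda>k. q k \<cdot> h k) (\<lambda>k. g k \<cdot> p k)"
    unfolding is_direct_sum_def
  proof (intro conjI allI impI)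
    show "q k \<cdot> h k \<in> hom C (rep (r k)) X" "g k \<cdot> p k \<in> hom C X (rep (r k))" if "k < n" for k
      using that by (auto intro: cmp_in_hom[OF q h] cmp_in_hom[OF g p])
    show "(g k \<cdot> p k) \<cdot> q l \<cdot> h l = (if k = l then idm C (rep (r k)) else 0)" if "k < n" "l < n" for k l
    proof -
      have "(g k \<cdot> p k) \<cdot> q l \<cdot> h l = g k \<cdot> (p k \<cdot> q l) \<cdot> h l"
        using that
        by (simp add: cmp_assoc[OF g p cmp_in_hom[OF q h]] cmp_assoc[OF p q h])
      then show ?thesis
        using that
        by (simp add: pq cmp_id_left[OF h] gh cmp_0_left[OF h] cmp_0_right[OF g])
    qed
    have "(q k \<cdot> h k) \<cdot> g k \<cdot> p k = q k \<cdot> p k" if "k < n" for k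
    proof -
      have "(q k \<cdot> h k) \<cdot> g k \<cdot> p k = q k \<cdot> (h k \<cdot> g k) \<cdot> p k"
        using that
        by (simp add: cmp_assoc[OF q h cmp_in_hom[OF g p]] cmp_assoc[OF h g p])
      then show ?thesis using that by (simp add: hg cmp_id_left[OF p])
    qed
    then show "(\<Sum>k<n. (q k \<cdot> h k) \<cdot> g k \<cdot> p k) = idm C X" by (simp add: id)
  qed
  then show ?thesis by (rule that)
qed

lemma schur:
  assumes "i \<noteq> j"
  shows "hom C (rep i) (rep j) = {0}"
proof (rule ccontr)
  assume "hom C (rep i) (rep j) \<noteq> {0}"
  then obtain f where "f \<in> hom C (rep i) (rep j)" "f \<noteq> 0" using hom_0[of "rep i" "rep j"] by blast
  then have "isomorphic C (rep i) (rep j)"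
    using simple_hom_zero_or_iso[OF rep_simple rep_simple] by (auto simp: isomorphic_def)
  moreover have "isomorphic C (rep i) (rep i)"
    using id_in_hom[of "rep i"] cmp_id_left[OF id_in_hom, of "rep i"]
    by (auto simp: isomorphic_def is_iso_def intro!: exI[of _ "idm C (rep i)"] bexI[of _ "idm C (rep i)"])
  ultimately show False using rep_unique[OF rep_simple[of i]] assms by blast
qed

text \<open>
  By Schur's lemma only the summands isomorphic to \<open>m\<close> contribute; on them projections and
  inclusions are dual to each other, which gives the linear independence.
\<close>

lemma
  assumes d: "is_direct_sum C n (\<lambda>k. rep (r k)) X q p"
  shows basis_hom_to_rep: "basis_family {k. k < n \<and> r k = m} p (hom C X (rep m))"
    and basis_hom_from_rep: "basis_family {k. k < n \<and> r k = m} q (hom C (rep m) X)"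
proof -
  let ?A = "{k. k < n \<and> r k = m}"
  have q: "k < n \<Longrightarrow> q k \<in> hom C (rep (r k)) X" and p: "k < n \<Longrightarrow> p k \<in> hom C X (rep (r k))"
    and pq: "k < n \<Longrightarrow> l < n \<Longrightarrow> p k \<cdot> q l = (if k = l then idm C (rep (r k)) else 0)" for k l
    using d by (auto simp: is_direct_sum_def)
  have id: "(\<Sum>k<n. q k \<cdot> p k) = idm C X" using d by (simp add: is_direct_sum_def)
  have A: "finite ?A" "?A \<subseteq> {..<n}" by auto
  have scalar: "\<exists>c. f = c \<odot> idm C (rep m) " if "f \<in> hom C (rep m) (rep m)" for f
    using that by (auto simp: rep_End)
  show "basis_family ?A p (hom C X (rep m))"
    unfolding basis_family_def
  proof (intro conjI allI ballI impI)
    show "finite ?A" by (fact A)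
    show "(\<Sum>a\<in>?A. c a \<odot> p a) \<in> hom C X (rep m)" for c
      using p by (intro hom_sum hom_smult) auto
    show "\<exists>c. v = (\<Sum>a\<in>?A. c a \<odot> p a)" if v: "v \<in> hom C X (rep m)" for v
    proof -
      have vq: "v \<cdot> q k \<in> hom C (rep (r k)) (rep m)" if "k < n" for k
        using that by (rule cmp_in_hom[OF v q])
      have "\<forall>k\<in>?A. \<exists>c. v \<cdot> q k = c \<odot> idm C (rep m)" using vq scalar by auto
      then obtain c where c: "\<And>k. k \<in> ?A \<Longrightarrow> v \<cdot> q k = c k \<odot> idm C (rep m)" by metis
      have "v = v \<cdot> (\<Sum>k<n. q k \<cdot> p k)" by (simp add: id cmp_id_right[OF v])
      also have "\<dots> = (\<Sum>k<n. v \<cdot> q k \<cdot> p k)"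
        by (rule cmp_sum_right[OF v]) (auto intro: cmp_in_hom[OF q p])
      also have "\<dots> = (\<Sum>k<n. (v \<cdot> q k) \<cdot> p k)"
        by (intro sum.cong) (auto simp: cmp_assoc[OF v q p])
      also have "\<dots> = (\<Sum>k\<in>?A. (v \<cdot> q k) \<cdot> p k)"
      proof (rule sum.mono_neutral_right)
        show "\<forall>k\<in>{..<n} - ?A. (v \<cdot> q k) \<cdot> p k = 0"
        proof
          fix k assume k: "k \<in> {..<n} - ?A"
          then have "v \<cdot> q k = 0" using vq[of k] schur[of "r k" m] by auto
          then show "(v \<cdot> q k) \<cdot> p k = 0" using k by (simp add: cmp_0_left[OF p])
        qed
      qed (use A in auto)
      also have "\<dots> = (\<Sum>k\<in>?A. c k \<odot> p k)"
      proof (rule sum.cong[OF refl])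
        fix k assume k: "k \<in> ?A"
        then have "p k \<in> hom C X (rep m)" using p by auto
        then show "(v \<cdot> q k) \<cdot> p k = c k \<odot> p k"
          unfolding c[OF k] by (simp add: cmp_smult_left[OF id_in_hom] cmp_id_left)
      qed
      finally show ?thesis by blast
    qed
    show "c a = 0" if z: "(\<Sum>a\<in>?A. c a \<odot> p a) = 0" and a: "a \<in> ?A" for c a
    proof -
      have qa: "q a \<in> hom C (rep m) X" using a q by auto
      have "0 = (\<Sum>k\<in>?A. c k \<odot> p k) \<cdot> q a" using z cmp_0_left[OF qa] by simp
      also have "\<dots> = (\<Sum>k\<in>?A. (c k \<odot> p k) \<cdot> q a)"
        using p by (intro cmp_sum_left[OF qa, of _ _ "rep m"] A hom_smult) auto
      also have "\<dots> = (\<Sum>k\<in>?A. if k = a then c k \<odot> idm C (rep m) else 0)"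
        using a by (intro sum.cong) (auto simp: cmp_smult_left[OF p qa] pq)
      also have "\<dots> = c a \<odot> idm C (rep m)" using a by (simp add: A)
      finally show ?thesis using scalar_eq_iff[of "c a" m 0] by simp
    qed
  qed
  show "basis_family ?A q (hom C (rep m) X)"
    unfolding basis_family_def
  proof (intro conjI allI ballI impI)
    show "finite ?A" by (fact A)
    show "(\<Sum>a\<in>?A. c a \<odot> q a) \<in> hom C (rep m) X" for c
      using q by (intro hom_sum hom_smult) auto
    show "\<exists>c. v = (\<Sum>a\<in>?A. c a \<odot> q a)" if v: "v \<in> hom C (rep m) X" for v
    proof -
      have pv: "p k \<cdot> v \<in> hom C (rep m) (rep (r k))" if "k < n" for k
        by (rule cmp_in_hom[OF p[OF that] v])
      have "\<forall>k\<in>?A. \<exists>c. p k \<cdot> v = c \<odot> idm C (rep m)" using pv scalar by auto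
      then obtain c where c: "\<And>k. k \<in> ?A \<Longrightarrow> p k \<cdot> v = c k \<odot> idm C (rep m)" by metis
      have "v = (\<Sum>k<n. q k \<cdot> p k) \<cdot> v" by (simp add: id cmp_id_left[OF v])
      also have "\<dots> = (\<Sum>k<n. (q k \<cdot> p k) \<cdot> v)"
        by (rule cmp_sum_left[OF v]) (auto intro: cmp_in_hom[OF q p])
      also have "\<dots> = (\<Sum>k<n. q k \<cdot> p k \<cdot> v)"
        by (intro sum.cong) (auto simp: cmp_assoc[OF q p v])
      also have "\<dots> = (\<Sum>k\<in>?A. q k \<cdot> p k \<cdot> v)"
      proof (rule sum.mono_neutral_right)
        show "\<forall>k\<in>{..<n} - ?A. q k \<cdot> p k \<cdot> v = 0"
        proof
          fix k assume k: "k \<in> {..<n} - ?A"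
          then have "p k \<cdot> v = 0" using pv[of k] schur[of m "r k"] by auto
          then show "q k \<cdot> p k \<cdot> v = 0" using k by (simp add: cmp_0_right[OF q])
        qed
      qed (use A in auto)
      also have "\<dots> = (\<Sum>k\<in>?A. c k \<odot> q k)"
      proof (rule sum.cong[OF refl])
        fix k assume k: "k \<in> ?A"
        then have "q k \<in> hom C (rep m) X" using q by auto
        then show "q k \<cdot> p k \<cdot> v = c k \<odot> q k"
          unfolding c[OF k] by (simp add: cmp_smult_right[OF _ id_in_hom] cmp_id_right)
      qed
      finally show ?thesis by blast
    qed
    show "c a = 0" if z: "(\<Sum>a\<in>?A. c a \<odot> q a) = 0" and a: "a \<in> ?A" for c a
    proof -
      have pa: "p a \<in> hom C X (rep m)" using a p by auto
      have "0 = p a \<cdot> (\<Sum>k\<in>?A. c k \<odot> q k)" using z cmp_0_right[OF pa] by simp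
      also have "\<dots> = (\<Sum>k\<in>?A. p a \<cdot> (c k \<odot> q k))"
        using q by (intro cmp_sum_right[OF pa, of _ _ "rep m"] A hom_smult) auto
      also have "\<dots> = (\<Sum>k\<in>?A. if k = a then c k \<odot> idm C (rep m) else 0)"
        using a by (intro sum.cong) (auto simp: cmp_smult_right[OF pa q] pq)
      also have "\<dots> = c a \<odot> idm C (rep m)" using a by (simp add: A)
      finally show ?thesis using scalar_eq_iff[of "c a" m 0] by simp
    qed
  qed
qed

definition fusion_mult :: "'o \<Rightarrow> 'i \<Rightarrow> nat" where
  "fusion_mult X m = dim (hom C X (rep m))"

lemma fusion_mult_direct_sum:
  "is_direct_sum C n (\<lambda>k. rep (r k)) X q p \<Longrightarrow> fusion_mult X m = card {k. k < n \<and> r k = m}"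
  unfolding fusion_mult_def by (rule dim_basis_family[OF basis_hom_to_rep])

lemma fusion_mult_eq_dim_hom_from_rep: "fusion_mult X m = dim (hom C (rep m) X)"
proof -
  obtain n r q p where d: "is_direct_sum C n (\<lambda>k. rep (r k)) X q p" by (rule decomposition)
  show ?thesis
    using fusion_mult_direct_sum[OF d] dim_basis_family[OF basis_hom_from_rep[OF d]] by simp
qed

lemma S_val_fusion: "S_val C X Y = (\<Sum>m\<in>UNIV. of_nat (fusion_mult Y m) * S_val C X (rep m))"
proof -
  obtain n r q p where d: "is_direct_sum C n (\<lambda>k. rep (r k)) Y q p" by (rule decomposition)
  have "S_val C X Y = (\<Sum>k<n. S_val C X (rep (r k)))" by (rule S_val_direct_sum[OF d])
  also have "\<dots> = (\<Sum>m\<in>UNIV. \<Sum>k\<in>{k \<in> {..<n}. r k = m}. S_val C X (rep (r k)))"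
    by (rule sum.group[symmetric]) auto
  also have "\<dots> = (\<Sum>m\<in>UNIV. of_nat (fusion_mult Y m) * S_val C X (rep m))"
    by (intro sum.cong) (auto simp: fusion_mult_direct_sum[OF d] intro!: arg_cong[of _ _ card])
  finally show ?thesis .
qed

lemma qdim_eq_S_val: "qdim C X = S_val C (rep u) X"
  by (simp add: rep_unit S_val_unit)

text \<open>
  By \<open>duality_adjunction\<close>, with \<open>k\<close> as the dual of its dual, \<open>Hom(k \<otimes> j, m)\<close> and \<open>Hom(j, k* \<otimes> m)\<close> are
  isomorphic, and the multiplicity of a simple object can be counted by morphisms into it or out of it.
\<close>

lemma frobenius_reciprocity: "fusion_mult (rep k \<otimes> rep j) m = fusion_mult (dual C (rep k) \<otimes> rep m) j"
proof -
  let ?X = "rep k" and ?D = "dual C (rep k)"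
  obtain n where d: "dual_pair ?D ?X (Ev ?X \<diamondop> Braid ?X ?D) n"
    by (rule dual_pair_braided[OF dual_pair_dual])
  let ?n = "mor n"
  let ?L = "\<lambda>f. (idm C ?D \<star> f) \<cdot> (?n \<star> idm C (rep j))"
  have bij: "bij_betw ?L (hom C (?X \<otimes> rep j) (rep m)) (hom C (rep j) (?D \<otimes> rep m))"
    by (rule duality_adjunction[OF d])
  note i = id_in_hom
  have n: "?n \<in> hom C one (?D \<otimes> ?X)" using dual_pairD(4-6)[OF d] by (simp add: wf_def)
  have n': "?n \<star> idm C (rep j) \<in> hom C (rep j) (?D \<otimes> ?X \<otimes> rep j)"
    using tensm_in_hom[OF n i] by simp
  obtain l r q p where dec: "is_direct_sum C l (\<lambda>k. rep (r k)) (?X \<otimes> rep j) q p"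
    by (rule decomposition)
  have "basis_family {k. k < l \<and> r k = m} (\<lambda>a. ?L (p a)) (hom C (rep j) (?D \<otimes> rep m))"
  proof (rule basis_family_image[OF basis_hom_to_rep[OF dec] hom_subspace _ _ bij])
    fix f g assume f: "f \<in> hom C (?X \<otimes> rep j) (rep m)" and g: "g \<in> hom C (?X \<otimes> rep j) (rep m)"
    show "?L (f + g) = ?L f + ?L g"
      by (simp add: tensm_add_right[OF i f g] cmp_add_left[OF tensm_in_hom[OF i f] tensm_in_hom[OF i g] n'])
  next
    fix a f assume f: "f \<in> hom C (?X \<otimes> rep j) (rep m)"
    show "?L (a \<odot> f) = a \<odot> ?L f"
      by (simp add: tensm_smult_right[OF i f] cmp_smult_left[OF tensm_in_hom[OF i f] n'])
  qed
  then have "dim (hom C (rep j) (?D \<otimes> rep m)) = card {k. k < l \<and> r k = m}"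
    by (rule dim_basis_family)
  then show ?thesis
    by (simp only: fusion_mult_direct_sum[OF dec] fusion_mult_eq_dim_hom_from_rep[of _ j])
qed

end

section \<open>Orthogonality of characters\<close>

context semisimple_category
begin

abbreviation d :: "'i \<Rightarrow> complex" where "d j \<equiv> qdim C (rep j)"

abbreviation S :: "'i \<Rightarrow> 'i \<Rightarrow> complex" where "S i j \<equiv> S_val C (rep i) (rep j)"

lemma qdim_fusion: "qdim C Y = (\<Sum>m\<in>UNIV. of_nat (fusion_mult Y m) * d m)"
  unfolding qdim_eq_S_val by (rule S_val_fusion)

lemma qdim_tens: "qdim C (X \<otimes> Y) = qdim C X * qdim C Y"
  using S_val_tens[of u X Y] by (simp add: rep_unit S_val_unit qdim_unit)

text \<open>
  Let multiplication by \<open>k\<close> act on one factor of the hermitian product of the dimension with a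
  character, or let its adjoint, multiplication by the dual of \<open>k\<close>, act on the other.  The entries of
  \<open>S\<close> are the values of the character times \<open>dim(i)\<close>, whence the factor \<open>dim(i)\<close> on the right.
\<close>

lemma character_sum_shift:
  "(\<Sum>j\<in>UNIV. cnj (d j) * S i j) * S i k = d i * cnj (d k) * (\<Sum>m\<in>UNIV. cnj (d m) * S i m)"
proof -
  have "(\<Sum>j\<in>UNIV. cnj (d j) * S i j) * S i k
      = d i * (\<Sum>j\<in>UNIV. cnj (d j) * S_val C (rep i) (rep k \<otimes> rep j))"
    unfolding sum_distrib_left sum_distrib_right
    by (intro sum.cong refl) (use S_val_tens[of i "rep k"] in \<open>simp add: algebra_simps\<close>)
  also have "(\<Sum>j\<in>UNIV. cnj (d j) * S_val C (rep i) (rep k \<otimes> rep j))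
      = (\<Sum>j\<in>UNIV. \<Sum>m\<in>UNIV. cnj (d j) * (of_nat (fusion_mult (rep k \<otimes> rep j) m) * S i m))"
    by (subst S_val_fusion) (simp add: sum_distrib_left)
  also have "\<dots> = (\<Sum>m\<in>UNIV. \<Sum>j\<in>UNIV. cnj (of_nat (fusion_mult (dual C (rep k) \<otimes> rep m) j) * d j) * S i m)"
    by (subst sum.swap) (simp add: frobenius_reciprocity algebra_simps)
  also have "\<dots> = (\<Sum>m\<in>UNIV. cnj (qdim C (dual C (rep k) \<otimes> rep m)) * S i m)"
    by (subst qdim_fusion) (simp add: sum_distrib_right)
  also have "\<dots> = cnj (d k) * (\<Sum>m\<in>UNIV. cnj (d m) * S i m)"
    by (simp add: qdim_tens qdim_dual sum_distrib_left algebra_simps)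
  finally show ?thesis by (simp add: mult.assoc)
qed

lemma dim_norm_sum_nonzero: "(\<Sum>j\<in>UNIV. cnj (d j) * d j) \<noteq> 0"
proof
  assume z: "(\<Sum>j\<in>UNIV. cnj (d j) * d j) = 0"
  have "(\<Sum>j\<in>UNIV. cnj (d j) * d j) = of_real (\<Sum>j\<in>UNIV. (cmod (d j))\<^sup>2)"
    unfolding of_real_sum complex_norm_square by (simp add: mult.commute)
  then have "(\<Sum>j\<in>UNIV. (cmod (d j))\<^sup>2) = 0" using z by (metis of_real_eq_0_iff)
  then show False by (simp add: sum_nonneg_eq_0_iff rep_dim)
qed

lemma dim_real: "cnj (d k) = d k"
proof -
  have "S u j = d j" for j by (simp add: qdim_eq_S_val)
  then show ?thesis
    using character_sum_shift[of u k] dim_norm_sum_nonzero by (simp add: rep_unit qdim_unit)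
qed

lemma global_dim_nonzero: "global_dim C rep \<noteq> 0"
  using dim_norm_sum_nonzero by (simp add: global_dim_def dim_real power2_eq_square)

lemma row_orthogonal_or_proportional:
  "(\<Sum>j\<in>UNIV. d j * S i j) = 0 \<or> (\<forall>k. S i k = d i * d k)"
  using character_sum_shift[of i] by (auto simp: dim_real)

section \<open>Duality of simple objects and the S-matrix\<close>

text \<open>
  Transposition identifies endomorphisms of the dual with those of the simple object.
\<close>

lemma endo_dual_rep:
  assumes g: "g \<in> hom C (dual C (rep i)) (dual C (rep i))"
  shows "\<exists>a. g = a \<odot> idm C (dual C (rep i))"
proof -
  let ?X = "rep i" and ?D = "dual C (rep i)"
  note z = dual_pairD(7,8)[OF dual_pair_dual[of ?X]]
  define G where "G = Arrow ?D ?D g"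
  have [simp]: "wf G" "src G = ?D" "tgt G = ?D" using g by (simp_all add: G_def wf_def)
  define F where "F = Ev ?X \<diamondop> whisker one G ?X"
  have [simp]: "wf F" "src F = ?D \<otimes> ?X" "tgt F = one" by (simp_all add: F_def)
  define H where "H = whisker ?X F one \<diamondop> whisker one (Coev ?X) ?X"
  have [simp]: "wf H" "src H = ?X" "tgt H = ?X" by (simp_all add: H_def)
  obtain a where a: "H = scal a (Id ?X)" by (rule endo_rep[of H i]) auto
  have 1: "Ev ?X \<diamondop> whisker (?D \<otimes> ?X) F one = F \<diamondop> whisker one (Ev ?X) (?D \<otimes> ?X)"
    using interchange[of "Ev ?X" F one one one] by simp
  have 2: "whisker one (Ev ?X) (?D \<otimes> ?X) \<diamondop> whisker ?D (Coev ?X) ?X = Id (?D \<otimes> ?X)"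
    using arg_cong[OF z(2), of "\<lambda>x. whisker one x ?X"] by (simp add: flat)
  have "Ev ?X \<diamondop> whisker ?D H one = F"
    by (simp add: H_def flat comp_cong22[OF 1] 2)
  then have F: "F = scal a (Ev ?X)" by (simp add: a whisker_scal comp_scal_right)
  have 3: "whisker one G (?X \<otimes> ?D) \<diamondop> whisker ?D (Coev ?X) one = whisker ?D (Coev ?X) one \<diamondop> G"
    using interchange[of G "Coev ?X" one one one] by simp
  have "whisker one F ?D \<diamondop> whisker ?D (Coev ?X) one
      = whisker one (Ev ?X) ?D \<diamondop> whisker ?D (Coev ?X) one \<diamondop> G"
    by (simp add: F_def flat 3)
  also have "\<dots> = G" by (simp add: comp_cong21[OF z(2)])
  finally have "G = scal a (Id ?D)" by (simp add: F whisker_scal comp_scal_left z(2))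
  then have "g = a \<odot> idm C ?D" by (simp add: G_def scal_def Id_def)
  then show ?thesis by blast
qed

text \<open>
  The dual of a simple object is simple: if two summands occurred, the idempotent of one of them
  would be a scalar that is nonzero on this summand and zero on the other.  There is at least one
  summand because the dimension is nonzero.
\<close>

lemma fusion_mult_dual_rep:
  obtains k where "\<And>m. fusion_mult (dual C (rep i)) m = (if m = k then 1 else 0)"
proof -
  let ?D = "dual C (rep i)"
  obtain n r q p where dec: "is_direct_sum C n (\<lambda>k. rep (r k)) ?D q p" by (rule decomposition)
  have q: "k < n \<Longrightarrow> q k \<in> hom C (rep (r k)) ?D" and p: "k < n \<Longrightarrow> p k \<in> hom C ?D (rep (r k))"
    and pq: "k < n \<Longrightarrow> l < n \<Longrightarrow> p k \<cdot> q l = (if k = l then idm C (rep (r k)) else 0)" for k l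
    using dec by (auto simp: is_direct_sum_def)
  have "n \<noteq> 0"
  proof
    assume "n = 0"
    then have "fusion_mult ?D m = 0" for m by (simp add: fusion_mult_direct_sum[OF dec])
    then show False using qdim_fusion[of ?D] rep_dim[of i] by (simp add: qdim_dual)
  qed
  moreover have "\<not> 1 < n"
  proof
    assume n: "1 < n"
    then have 0: "0 < n" by simp
    obtain a where a: "q 0 \<cdot> p 0 = a \<odot> idm C ?D"
      using endo_dual_rep[OF cmp_in_hom[OF q[OF 0] p[OF 0]]] by blast
    have *: "q 0 \<cdot> p 0 \<cdot> q k = a \<odot> q k" if "k < n" for k
      using cmp_assoc[OF q[OF 0] p[OF 0] q[OF that]]
      by (simp add: a cmp_smult_left[OF id_in_hom q[OF that]] cmp_id_left[OF q[OF that]])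
    have q_nz: "q k \<noteq> 0" if "k < n" for k
      using pq[OF that that] cmp_0_right[OF p[OF that]] rep_simple[of "r k"]
      by (auto simp: is_simple_def)
    have "a = 0"
      using *[OF n] pq[OF 0 n] q_nz[OF n] cmp_0_right[OF q[OF 0]] by auto
    then have "q 0 = 0"
      using *[OF 0] pq[OF 0 0] cmp_id_right[OF q[OF 0]] by simp
    then show False using q_nz[OF 0] by simp
  qed
  ultimately have "n = 1" by simp
  then have "fusion_mult ?D m = (if m = r 0 then 1 else 0)" for m
    by (auto simp: fusion_mult_direct_sum[OF dec] card_1_singleton_iff intro: exI[of _ 0])
  then show ?thesis by (rule that)
qed

lemma conjugate_index:
  obtains s where "\<And>i k. fusion_mult (rep i \<otimes> rep k) u = (if k = s i then 1 else 0)"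
proof -
  have "\<exists>k. \<forall>m. fusion_mult (dual C (rep i)) m = (if m = k then 1 else 0)" for i
    by (rule fusion_mult_dual_rep[of i]) blast
  then obtain s where "\<And>i m. fusion_mult (dual C (rep i)) m = (if m = s i then 1 else 0)" by metis
  then show ?thesis
    using that[of s] by (simp add: frobenius_reciprocity rep_unit)
qed

text \<open>
  Expand the product of two entries of one row by the character property; under the hypothesis the
  sum over all rows keeps only the unit among the constituents of the tensor product.
\<close>

lemma S_gram:
  assumes "\<And>i. (\<Sum>j\<in>UNIV. d j * S j i) = (if i = u then D else 0)"
  shows "(\<Sum>j\<in>UNIV. S j i * S j k) = D * of_nat (fusion_mult (rep i \<otimes> rep k) u)"
proof -
  have "(\<Sum>j\<in>UNIV. S j i * S j k) = (\<Sum>j\<in>UNIV. \<Sum>m\<in>UNIV. d j * (of_nat (fusion_mult (rep i \<otimes> rep k) m) * S j m))"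
    unfolding sum_distrib_left[symmetric] S_val_fusion[symmetric]
    by (simp add: S_val_tens[symmetric] mult.commute)
  also have "\<dots> = (\<Sum>m\<in>UNIV. of_nat (fusion_mult (rep i \<otimes> rep k) m) * (\<Sum>j\<in>UNIV. d j * S j m))"
    by (subst sum.swap) (simp add: sum_distrib_left algebra_simps)
  also have "\<dots> = (\<Sum>m\<in>UNIV. if m = u then of_nat (fusion_mult (rep i \<otimes> rep k) m) * D else 0)"
    by (intro sum.cong) (auto simp: assms)
  finally show ?thesis by simp
qed

lemma invertible_S_matrix:
  assumes "\<And>i. (\<Sum>j\<in>UNIV. d j * S j i) = (if i = u then global_dim C rep else 0)"
  shows "invertible (S_matrix C rep)"
proof -
  let ?D = "global_dim C rep"
  obtain s where s: "\<And>i k. fusion_mult (rep i \<otimes> rep k) u = (if k = s i then 1 else 0)"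
    by (rule conjugate_index) blast
  have gram: "(\<Sum>j\<in>UNIV. S j i * S j k) = (if k = s i then ?D else 0)" for i k
    using S_gram[of ?D i k, OF assms] by (simp add: s)
  \<comment> \<open>The left side of \<open>gram\<close> is symmetric in \<open>i\<close> and \<open>k\<close>, so duality is an involution.\<close>
  have "s (s i) = i" for i
  proof -
    have "(\<Sum>j\<in>UNIV. S j (s i) * S j i) = ?D"
      using gram[of i "s i"] by (simp add: mult.commute)
    then show ?thesis using gram[of "s i" i] global_dim_nonzero by (auto split: if_splits)
  qed
  then have "(\<chi> k j. S j (s k) / ?D) ** S_matrix C rep = mat 1"
    using global_dim_nonzero
    by (simp add: matrix_matrix_mult_def S_matrix_def mat_def vec_eq_iff gram
        sum_divide_distrib[symmetric])
  then show ?thesis by (auto simp: invertible_left_inverse)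
qed

text \<open>
  If \<open>i\<close> is not the unit, \<open>v\<close> separates the character of \<open>i\<close> from the dimension.
\<close>

lemma dim_sum_if_unit_in_image:
  assumes v: "\<And>i. (\<Sum>j\<in>UNIV. v $ j * S j i) = (if i = u then 1 else 0)"
  shows "(\<Sum>j\<in>UNIV. d j * S j i) = (if i = u then global_dim C rep else 0)"
proof (cases "i = u")
  case True
  have "S j u = d j" for j
    unfolding qdim_eq_S_val by (rule S_val_sym)
  then show ?thesis using True by (simp add: global_dim_def power2_eq_square)
next
  case False
  have "\<not> (\<forall>k. S i k = d i * d k)"
  proof
    assume *: "\<forall>k. S i k = d i * d k"
    have "S j i = d i * S j u" for j
      using *[rule_format, of j] by (simp add: qdim_eq_S_val S_val_sym[of "rep j"])
    then have "(\<Sum>j\<in>UNIV. v $ j * S j i) = d i * (\<Sum>j\<in>UNIV. v $ j * S j u)"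
      by (simp add: sum_distrib_left algebra_simps)
    then show False using v[of i] v[of u] False rep_dim[of i] by simp
  qed
  then have "(\<Sum>j\<in>UNIV. d j * S i j) = 0" using row_orthogonal_or_proportional by blast
  moreover have "S i j = S j i" for j by (rule S_val_sym)
  ultimately show ?thesis using False by simp
qed

end

theorem lemma17:
  fixes C :: "('o, 'm :: ab_group_add, 'x) balanced_cat_scheme"
    and rep :: "'i :: finite \<Rightarrow> 'o" and u :: 'i
  assumes "semisimple_category C rep u"
  shows "((\<exists>d :: complex ^ 'i. \<forall>i. (\<Sum>j\<in>UNIV. d $ j * S_matrix C rep $ j $ i) = (if i = u then 1 else 0))
            \<longleftrightarrow> (\<forall>i. (\<Sum>j\<in>UNIV. qdim C (rep j) * S_matrix C rep $ j $ i)
                       = (if i = u then global_dim C rep else 0)))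
       \<and> ((\<forall>i. (\<Sum>j\<in>UNIV. qdim C (rep j) * S_matrix C rep $ j $ i)
                       = (if i = u then global_dim C rep else 0))
            \<longleftrightarrow> invertible (S_matrix C rep))"
proof -
  interpret semisimple_category C rep u by (fact assms)
  let ?S = "S_matrix C rep"
  let ?one = "\<exists>d :: complex ^ 'i. \<forall>i. (\<Sum>j\<in>UNIV. d $ j * ?S $ j $ i) = (if i = u then 1 else 0)"
  let ?two = "\<forall>i. (\<Sum>j\<in>UNIV. qdim C (rep j) * ?S $ j $ i) = (if i = u then global_dim C rep else 0)"
  have ?two if ?one
  proof -
    obtain v :: "complex ^ 'i"
      where "\<And>i. (\<Sum>j\<in>UNIV. v $ j * S j i) = (if i = u then 1 else 0)"
      using \<open>?one\<close> by (auto simp: S_matrix_def)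
    then show ?thesis using dim_sum_if_unit_in_image[of v] by (simp add: S_matrix_def)
  qed
  moreover have "invertible ?S" if ?two
    using that by (intro invertible_S_matrix) (simp add: S_matrix_def)
  moreover have ?one if "invertible ?S"
  proof -
    obtain A where "A ** ?S = mat 1" using \<open>invertible ?S\<close> by (auto simp: invertible_def)
    then have "(\<Sum>j\<in>UNIV. A $ u $ j * ?S $ j $ i) = (if i = u then 1 else 0)" for i
      by (simp add: matrix_matrix_mult_def mat_def vec_eq_iff)
    then show ?thesis by blast
  qed
  ultimately show ?thesis by blast
qed

end
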